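(* Let $\mathbb{K}$ be a field and $\nu$ a valuation on $\mathbb{K}[x]$. Then $\nu$ is valuation-transcendental if and only if there exists a key polynomial $Q\in\mathbb{K}[x]$ for $\nu$ such that $\nu=\nu_Q$.
   Context: A valuation on a commutative ring $R$ is a map $\nu:R\to\Gamma\cup\{\infty\}$ ($\Gamma$ an ordered abelian group) with $\nu(ab)=\nu(a)+\nu(b)$, $\nu(a+b)\ge\min\{\nu(a),\nu(b)\}$, $\nu(1)=0$, $\nu(0)=\infty$. Its support is $\mathrm{supp}(\nu)=\{a:\nu(a)=\infty\}$; $\nu$ is Krull if $\mathrm{supp}(\nu)=\{0\}$. A Krull valuation on $\mathbb{K}[x]$ extends uniquely to $\mathbb{K}(x)$; $\nu\mathbb{K}(x)$ and $\nu\mathbb{K}$ denote the value groups of $\nu$ on $\mathbb{K}(x)$ and on $\mathbb{K}$, and $\mathbb{K}(x)\nu$, $\mathbb{K}\nu$ the residue fields. Truncation: for a non-constant $q\in\mathbb{K}[x]$, every $f$ has a unique $q$-expansion $f=f_0+f_1q+\dots+f_sq^s$ with $\deg f_i<\deg q$; set $\nu_q(f)=\min_i\nu(f_iq^i)$. Key polynomials: let $\alpha=\min\{\deg g: g\in\mathrm{supp}(\nu)\setminus\{0\}\}$ if $\mathrm{supp}(\nu)\neq\{0\}$, and $\alpha=\infty$ otherwise. The Hasse derivative of order $b$ of $f=\sum a_ix^i$ is $\partial_bf=\sum_{i\ge b}\binom{i}{b}a_ix^{i-b}$. For nonzero $f$: if $0<\deg f<\alpha$, $\epsilon(f)=\max_{1\le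 b\le\deg f}\{(\nu(f)-\nu(\partial_bf))/b : \nu(f),\nu(\partial_bf)\in\Gamma\}\in\Gamma\otimes\mathbb{Q}$; if $\deg f=0$, $\epsilon(f)=-\infty$; if $f$ generates $\mathrm{supp}(\nu)$, $\epsilon(f)=\infty$. A monic $Q\in\mathbb{K}[x]$ is a key polynomial for $\nu$ if for every $f$ (for which $\epsilon(f)$ is defined), $\epsilon(f)\ge\epsilon(Q)$ implies $\deg f\ge\deg Q$. $\nu$ is value-transcendental if it is not Krull or $\nu\mathbb{K}(x)/\nu\mathbb{K}$ is not a torsion group; $\nu$ (Krull) is residue-transcendental if $\mathbb{K}(x)\nu\mid\mathbb{K}\nu$ is transcendental; $\nu$ is valuation-transcendental if it is value-transcendental or residue-transcendental. *)

theory Defs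
  imports "HOL-Computational_Algebra.Polynomial" "HOL-Library.Extended"
begin

text \<open>Values live in \<open>\<Gamma> \<union> {\<infinity>}\<close>, rendered as \<open>'g extended\<close> with
  \<open>Fin\<close> for elements of \<open>\<Gamma>\<close> and \<open>Pinf\<close> for \<open>\<infinity>\<close> (\<open>Minf\<close> is never taken).\<close>

fun fin_val :: "'g::zero extended \<Rightarrow> 'g" where
  "fin_val (Fin x) = x"
| "fin_val Pinf = 0"
| "fin_val Minf = 0"

primrec gmul :: "nat \<Rightarrow> 'g::ab_group_add \<Rightarrow> 'g" where
  "gmul 0 x = 0"
| "gmul (Suc n) x = x + gmul n x"

definition valuation :: "('a::field poly \<Rightarrow> 'g::linordered_ab_group_add extended) \<Rightarrow> bool" where
  "valuation \<nu> \<longleftrightarrow>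
     (\<forall>f. \<nu> f \<noteq> Minf) \<and>
     (\<forall>a b. \<nu> (a * b) = \<nu> a + \<nu> b) \<and>
     (\<forall>a b. min (\<nu> a) (\<nu> b) \<le> \<nu> (a + b)) \<and>
     \<nu> 1 = Fin 0 \<and> \<nu> 0 = Pinf"

definition supp :: "('a::field poly \<Rightarrow> 'g::linordered_ab_group_add extended) \<Rightarrow> 'a poly set" where
  "supp \<nu> = {f. \<nu> f = Pinf}"

definition krull :: "('a::field poly \<Rightarrow> 'g::linordered_ab_group_add extended) \<Rightarrow> bool" where
  "krull \<nu> \<longleftrightarrow> supp \<nu> = {0}"

text \<open>Value group of the (unique) extension of a Krull \<open>\<nu>\<close> to \<open>K(x)\<close>:
  \<open>\<nu>(f/g) = \<nu> f - \<nu> g\<close>.\<close>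
definition value_group_Kx :: "('a::field poly \<Rightarrow> 'g::linordered_ab_group_add extended) \<Rightarrow> 'g set" where
  "value_group_Kx \<nu> = {fin_val (\<nu> f) - fin_val (\<nu> g) | f g. f \<noteq> 0 \<and> g \<noteq> 0}"

definition value_group_K :: "('a::field poly \<Rightarrow> 'g::linordered_ab_group_add extended) \<Rightarrow> 'g set" where
  "value_group_K \<nu> = {fin_val (\<nu> [:c:]) | c. c \<noteq> 0}"

definition value_quotient_torsion :: "('a::field poly \<Rightarrow> 'g::linordered_ab_group_add extended) \<Rightarrow> bool" where
  "value_quotient_torsion \<nu> \<longleftrightarrow>
     (\<forall>\<gamma>\<in>value_group_Kx \<nu>. \<exists>n>0. gmul n \<gamma> \<in> value_group_K \<nu>)"

definition value_transcendental :: "('a::field poly \<Rightarrow> 'g::linordered_ab_group_add extended) \<Rightarrow> bool" where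
  "value_transcendental \<nu> \<longleftrightarrow> \<not> krull \<nu> \<or> \<not> value_quotient_torsion \<nu>"

text \<open>For \<open>g \<noteq> 0\<close> with \<open>\<nu> g \<le> \<nu> f\<close>, the residue \<open>\<xi>\<close> of \<open>f/g\<close> in \<open>K(x)\<nu>\<close>
  is algebraic over \<open>K\<nu>\<close> iff there are \<open>c\<^sub>0,\<dots>,c\<^sub>n \<in> K\<close> with \<open>\<nu>(c\<^sub>i) \<ge> 0\<close>,
  some \<open>\<nu>(c\<^sub>i) = 0\<close> (so the reduced polynomial \<open>\<Sum> res(c\<^sub>i) T\<^sup>i\<close> over \<open>K\<nu>\<close> is nonzero),
  and \<open>\<nu>(\<Sum> c\<^sub>i (f/g)\<^sup>i) > 0\<close>, i.e. \<open>\<nu>(\<Sum> c\<^sub>i f\<^sup>i g\<^sup>n\<^sup>-\<^sup>i) > \<nu>(g\<^sup>n)\<close>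
  (so the reduced polynomial vanishes at \<open>\<xi>\<close>).\<close>
definition residue_algebraic ::
  "('a::field poly \<Rightarrow> 'g::linordered_ab_group_add extended) \<Rightarrow> 'a poly \<Rightarrow> 'a poly \<Rightarrow> bool" where
  "residue_algebraic \<nu> f g \<longleftrightarrow>
     (\<exists>(n::nat) (c::nat \<Rightarrow> 'a).
        (\<forall>i\<le>n. Fin 0 \<le> \<nu> [:c i:]) \<and>
        (\<exists>i\<le>n. \<nu> [:c i:] = Fin 0) \<and>
        \<nu> (g ^ n) < \<nu> (\<Sum>i\<le>n. smult (c i) (f ^ i * g ^ (n - i))))"

definition residue_transcendental :: "('a::field poly \<Rightarrow> 'g::linordered_ab_group_add extended) \<Rightarrow> bool" where
  "residue_transcendental \<nu> \<longleftrightarrow>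
     krull \<nu> \<and> (\<exists>f g. g \<noteq> 0 \<and> \<nu> g \<le> \<nu> f \<and> \<not> residue_algebraic \<nu> f g)"

definition valuation_transcendental :: "('a::field poly \<Rightarrow> 'g::linordered_ab_group_add extended) \<Rightarrow> bool" where
  "valuation_transcendental \<nu> \<longleftrightarrow> value_transcendental \<nu> \<or> residue_transcendental \<nu>"

text \<open>The \<open>i\<close>-th coefficient of the \<open>q\<close>-expansion \<open>f = \<Sum> f\<^sub>i q\<^sup>i\<close>, \<open>deg f\<^sub>i < deg q\<close>.\<close>
definition qexp_coeff :: "'a::field poly \<Rightarrow> 'a poly \<Rightarrow> nat \<Rightarrow> 'a poly" where
  "qexp_coeff q f i = (f div q ^ i) mod q"

text \<open>\<open>\<nu>\<^sub>q(f) = min\<^sub>i \<nu>(f\<^sub>i q\<^sup>i)\<close>; coefficients with \<open>i > deg f\<close> vanish.\<close>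
definition truncation ::
  "('a::field poly \<Rightarrow> 'g::linordered_ab_group_add extended) \<Rightarrow> 'a poly \<Rightarrow> 'a poly \<Rightarrow> 'g extended" where
  "truncation \<nu> q f = Min ((\<lambda>i. \<nu> (qexp_coeff q f i * q ^ i)) ` {..degree f})"

definition hasse_deriv :: "nat \<Rightarrow> 'a::field poly \<Rightarrow> 'a poly" where
  "hasse_deriv b f = (\<Sum>i\<in>{b..degree f}. monom (of_nat (i choose b) * coeff f i) (i - b))"

text \<open>Elements of \<open>{-\<infinity>} \<union> (\<Gamma> \<otimes> \<bbbQ>) \<union> {\<infinity>}\<close>: \<open>EQ \<gamma> b\<close> stands for \<open>\<gamma>/b\<close> (\<open>b > 0\<close>).\<close>
datatype 'g epsval = ENegInf | EQ 'g nat | EPosInf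

fun eps_le :: "'g::linordered_ab_group_add epsval \<Rightarrow> 'g epsval \<Rightarrow> bool" where
  "eps_le ENegInf _ = True"
| "eps_le _ EPosInf = True"
| "eps_le (EQ x b) (EQ y c) = (gmul c x \<le> gmul b y)"
| "eps_le _ _ = False"

text \<open>\<open>deg f < \<alpha>\<close>, where \<open>\<alpha>\<close> is the least degree of a nonzero element of the support
  (\<open>\<alpha> = \<infinity>\<close> if the support is \<open>{0}\<close>).\<close>
definition deg_lt_alpha :: "('a::field poly \<Rightarrow> 'g::linordered_ab_group_add extended) \<Rightarrow> 'a poly \<Rightarrow> bool" where
  "deg_lt_alpha \<nu> f \<longleftrightarrow> (\<forall>g\<in>supp \<nu> - {0}. degree f < degree g)"

definition generates_supp :: "('a::field poly \<Rightarrow> 'g::linordered_ab_group_add extended) \<Rightarrow> 'a poly \<Rightarrow> bool" where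
  "generates_supp \<nu> f \<longleftrightarrow> f \<noteq> 0 \<and> supp \<nu> = {f * h | h. True}"

text \<open>The finite set of quantities whose maximum is \<open>\<epsilon>(f)\<close>; it is empty exactly
  when \<open>\<epsilon>(f)\<close> is undefined.\<close>
definition eps_cands :: "('a::field poly \<Rightarrow> 'g::linordered_ab_group_add extended) \<Rightarrow> 'a poly \<Rightarrow> 'g epsval set" where
  "eps_cands \<nu> f =
     (if f \<noteq> 0 \<and> degree f = 0 then {ENegInf}
      else if generates_supp \<nu> f then {EPosInf}
      else if f \<noteq> 0 \<and> 0 < degree f \<and> deg_lt_alpha \<nu> f then
        {EQ (fin_val (\<nu> f) - fin_val (\<nu> (hasse_deriv b f))) b | b.
           1 \<le> b \<and> b \<le> degree f \<and> \<nu> f \<noteq> Pinf \<and> \<nu> (hasse_deriv b f) \<noteq> Pinf}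
      else {})"

definition eps_defined :: "('a::field poly \<Rightarrow> 'g::linordered_ab_group_add extended) \<Rightarrow> 'a poly \<Rightarrow> bool" where
  "eps_defined \<nu> f \<longleftrightarrow> eps_cands \<nu> f \<noteq> {}"

definition eps_ge :: "('a::field poly \<Rightarrow> 'g::linordered_ab_group_add extended) \<Rightarrow> 'a poly \<Rightarrow> 'a poly \<Rightarrow> bool" where
  "eps_ge \<nu> f g \<longleftrightarrow> (\<exists>e\<in>eps_cands \<nu> f. \<forall>e'\<in>eps_cands \<nu> g. eps_le e' e)"

definition key_polynomial :: "('a::field poly \<Rightarrow> 'g::linordered_ab_group_add extended) \<Rightarrow> 'a poly \<Rightarrow> bool" where
  "key_polynomial \<nu> Q \<longleftrightarrow>
     lead_coeff Q = 1 \<and> eps_defined \<nu> Q \<and>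
     (\<forall>f. eps_defined \<nu> f \<and> eps_ge \<nu> f Q \<longrightarrow> degree Q \<le> degree f)"

end

theory Submission
  imports Defs
begin

text \<open>
  Assume that \<open>\<nu>\<close> is Krull; otherwise a monic generator of the support is the required key polynomial.
  If \<open>\<epsilon> = \<gamma>/b\<close>, then \<open>\<epsilon>(f) \<le> \<epsilon>\<close> says exactly that \<open>f(x + y) = \<Sum> \<partial>\<^sub>i f y\<^sup>i\<close> has the value \<open>\<nu>(f)\<close>
  under the Gauss extension \<open>w\<close> of \<open>\<nu>\<close> with \<open>w(y) = \<epsilon>\<close>, and \<open>\<epsilon>(f) < \<epsilon>\<close> that moreover the initial form
  of \<open>f(x + y)\<close> has degree \<open>0\<close> in \<open>y\<close>. If \<open>\<epsilon> = \<epsilon>(q)\<close> and all polynomials of smaller degree than \<open>q\<close> have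
  smaller \<open>\<epsilon>\<close>, the terms of a \<open>q\<close>-expansion have initial forms of distinct degrees in \<open>y\<close>, so that
  \<open>w(f(x + y)) = \<nu>\<^sub>q(f)\<close>.

  If \<open>\<epsilon>\<close> has a maximum, then a \<open>Q\<close> of least degree attaining it is a key polynomial with \<open>\<nu> = \<nu>\<^sub>Q\<close>. If it has
  none, then for given \<open>f, g\<close> choose \<open>q\<close> of least degree \<open>n\<close> with \<open>\<epsilon>(q) > \<epsilon>(f g)\<close>. Each \<open>f\<^sup>i g\<^sup>n\<^sup>-\<^sup>i\<close> agrees
  with its remainder modulo \<open>q\<close> up to terms of larger value, and these \<open>n + 1\<close> remainders are linearly
  dependent over \<open>K\<close>. The resulting relation shows that the value of \<open>f/g\<close> is torsion modulo the
  value group of \<open>K\<close> and that its residue is algebraic. Conversely, if \<open>\<nu> = \<nu>\<^sub>Q\<close> and \<open>n \<nu>(Q) = \<nu>(a)\<close> with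
  \<open>a \<in> K\<close>, then the residue of \<open>Q\<^sup>n/a\<close> is transcendental.
\<close>

section \<open>Integer multiples in ordered abelian groups and arithmetic with \<infinity>\<close>

lemma gmul_add: "gmul (m + n) x = gmul m x + gmul n x"
  by (induction m) (simp_all add: add.assoc)

lemma gmul_zero [simp]: "gmul n 0 = 0"
  by (induction n) simp_all

lemma gmul_plus: "gmul n (x + y) = gmul n x + gmul n y"
  by (induction n) (simp_all add: ac_simps)

lemma gmul_uminus: "gmul n (- x) = - gmul n x"
  by (induction n) simp_all

lemma gmul_diff: "gmul n (x - y) = gmul n x - gmul n y"
  using gmul_plus[of n x "- y"] by (simp add: gmul_uminus)

lemma gmul_gmul: "gmul m (gmul n x) = gmul (m * n) x"
  by (induction m) (simp_all add: gmul_add)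

lemma gmul_commute: "gmul m (gmul n x) = gmul n (gmul m x)"
  by (simp add: gmul_gmul mult.commute)

lemma gmul_mono: "x \<le> y \<Longrightarrow> gmul n x \<le> gmul n (y::'g::linordered_ab_group_add)"
  by (induction n) (simp_all add: add_mono)

lemma gmul_strict_mono:
  assumes "0 < n" "x < (y::'g::linordered_ab_group_add)"
  shows "gmul n x < gmul n y"
proof -
  obtain k where "n = Suc k" using assms(1) by (cases n) auto
  moreover have "gmul k x \<le> gmul k y" using assms(2) by (simp add: gmul_mono)
  ultimately show ?thesis using assms(2) by (simp add: add_less_le_mono)
qed

lemma gmul_le_iff:
  "0 < n \<Longrightarrow> gmul n x \<le> gmul n y \<longleftrightarrow> x \<le> (y::'g::linordered_ab_group_add)"
  by (meson gmul_mono gmul_strict_mono leD not_le_imp_less)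

lemma Fin_add_mono:
  "Fin a \<le> x \<Longrightarrow> Fin b \<le> y \<Longrightarrow> Fin (a + b) \<le> x + (y::'g::linordered_ab_group_add extended)"
  by (cases x; cases y) (auto simp: add_mono)

lemma Fin_add_less_le_mono:
  "Fin a < x \<Longrightarrow> Fin b \<le> y \<Longrightarrow> Fin (a + b) < x + (y::'g::linordered_ab_group_add extended)"
  by (cases x; cases y) (auto simp: add_less_le_mono)

lemma Fin_add_le_less_mono:
  "Fin a \<le> x \<Longrightarrow> Fin b < y \<Longrightarrow> Fin (a + b) < x + (y::'g::linordered_ab_group_add extended)"
  by (cases x; cases y) (auto simp: add_le_less_mono)

lemma Fin_add_le_cancel [simp]:
  "x + Fin c \<le> y + Fin c \<longleftrightarrow> x \<le> (y::'g::linordered_ab_group_add extended)"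
  by (cases x; cases y) auto

lemma Fin_add_less_cancel [simp]:
  "x + Fin c < y + Fin c \<longleftrightarrow> x < (y::'g::linordered_ab_group_add extended)"
  by (simp add: less_le_not_le)

text \<open>Moving the finite summand across turns bounds on \<open>V s + Fin (gmul k c)\<close>
  into bounds on \<open>V s\<close> alone, the form in which \<open>V_sum_ge\<close>,
  \<open>V_sum_gt\<close> and \<open>V_sum_eq\<close> apply.\<close>

lemma Fin_shift:
  fixes r :: "'g::linordered_ab_group_add extended"
  shows "Fin x \<le> r + Fin y \<longleftrightarrow> Fin (x - y) \<le> r"
    and "Fin x < r + Fin y \<longleftrightarrow> Fin (x - y) < r"
    and "r + Fin y = Fin x \<longleftrightarrow> r = Fin (x - y)"
  by (cases r; auto simp: algebra_simps)+

section \<open>Valuations on commutative rings and their Gauss extensions\<close>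

text \<open>The ring is abstract so that \<open>gauss\<close> can speak of polynomials over it. In
  the application \<open>'r\<close> is \<open>'a poly\<close>, Taylor expansions are polynomials
  over that ring, and \<open>V\<close> is \<nu> or a positive multiple of \<nu>.\<close>

locale gen_valuation =
  fixes V :: "'r::comm_ring_1 \<Rightarrow> 'g::linordered_ab_group_add extended"
  assumes V_not_Minf [simp]: "V a \<noteq> Minf"
    and V_mult: "V (a * b) = V a + V b"
    and V_add: "min (V a) (V b) \<le> V (a + b)"
    and V_1 [simp]: "V 1 = Fin 0"
    and V_0 [simp]: "V 0 = Pinf"
begin

lemma V_minus_1 [simp]: "V (- 1) = Fin 0"
proof -
  have *: "V (- 1) + V (- 1) = Fin 0" using V_mult[of "- 1" "- 1"] by simp
  show ?thesis using * by (cases "V (- 1)") auto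
qed

lemma V_uminus [simp]: "V (- a) = V a"
  using V_mult[of "- 1" a] by (cases "V a") auto

lemma V_power: "V (a ^ n) = (if n = 0 then Fin 0 else case V a of Fin x \<Rightarrow> Fin (gmul n x) | _ \<Rightarrow> Pinf)"
  by (induction n) (auto simp: V_mult split: extended.splits)

lemma V_sum_ge:
  assumes "\<And>i. i \<in> I \<Longrightarrow> m \<le> V (f i)"
  shows "m \<le> V (sum f I)"
  using assms
  by (induction I rule: infinite_finite_induct)
     (auto intro: order_trans[OF _ V_add])

lemma V_sum_gt:
  assumes "\<And>i. i \<in> I \<Longrightarrow> Fin m < V (f i)"
  shows "Fin m < V (sum f I)"
  using assms
  by (induction I rule: infinite_finite_induct)
     (auto intro: order.strict_trans2[OF _ V_add])

lemma V_add_eq: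
  assumes "V a < V b"
  shows "V (a + b) = V a"
proof (rule antisym)
  show "V a \<le> V (a + b)" using V_add[of a b] assms by (simp add: min_absorb1)
  \<comment> \<open>The reverse inequality comes from writing
    \<open>a = (a + b) + (- b)\<close>.\<close>
  have "min (V (a + b)) (V b) \<le> V a" using V_add[of "a + b" "- b"] by simp
  then show "V (a + b) \<le> V a" using assms by (auto simp: min_def split: if_splits)
qed

lemma V_sum_eq:
  assumes "finite I" "i \<in> I" "V (f i) = Fin m" "\<And>j. j \<in> I \<Longrightarrow> j \<noteq> i \<Longrightarrow> Fin m < V (f j)"
  shows "V (sum f I) = Fin m"
proof -
  have "sum f I = f i + sum f (I - {i})" using assms by (simp add: sum.remove)
  moreover have "Fin m < V (sum f (I - {i}))" by (rule V_sum_gt) (use assms in auto)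
  ultimately show ?thesis using V_add_eq assms(3) by metis
qed

text \<open>For the Gauss extension of \<^term>\<open>V\<close> giving the variable the value \<open>c\<close>, the polynomial
  \<open>F\<close> has value \<open>m\<close>, and its initial form has degree \<open>d\<close>.\<close>
definition gauss :: "'g \<Rightarrow> 'r poly \<Rightarrow> 'g \<Rightarrow> nat \<Rightarrow> bool" where
  "gauss c F m d \<longleftrightarrow>
     (\<forall>i. Fin m \<le> V (coeff F i) + Fin (gmul i c)) \<and>
     V (coeff F d) + Fin (gmul d c) = Fin m \<and>
     (\<forall>i>d. Fin m < V (coeff F i) + Fin (gmul i c))"

text \<open>\<open>m\<close> is the minimum of the values
  \<open>V (coeff F i) + Fin (gmul i c)\<close>, and \<open>d\<close> is the largest index attaining
  it.\<close>

lemma gauss_unique: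
  assumes "gauss c F m d" "gauss c F m' d'"
  shows "m = m'" "d = d'"
proof -
  have "Fin m \<le> Fin m'" "Fin m' \<le> Fin m"
    using assms unfolding gauss_def by metis+
  then show "m = m'" by simp
  with assms show "d = d'" unfolding gauss_def
    by (metis less_irrefl linorder_neqE_nat)
qed

text \<open>Beyond the degree all values are \<open>Pinf\<close>, so the minimum runs over finitely
  many indices, and index \<open>i\<close> makes it finite.\<close>

lemma gauss_ex:
  assumes "coeff F i \<noteq> 0" "V (coeff F i) \<noteq> Pinf"
  obtains m d where "gauss c F m d"
proof -
  define u where "u i = V (coeff F i) + Fin (gmul i c)" for i
  define I where "I = {..max i (degree F)}"
  have I: "finite I" "I \<noteq> {}" unfolding I_def by auto
  have out: "u j = Pinf" if "j \<notin> I" for j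
    using that by (simp add: u_def I_def coeff_eq_0)
  define M where "M = Min (u ` I)"
  have "M \<le> u i" unfolding M_def by (rule Min_le) (auto simp: I_def)
  moreover have "u i \<noteq> Pinf" using assms unfolding u_def by (cases "V (coeff F i)") auto
  moreover have "M \<in> u ` I" unfolding M_def using I by (intro Min_in) auto
  moreover have "u j \<noteq> Minf" for j unfolding u_def by (cases "V (coeff F j)"; use V_not_Minf in force)
  ultimately obtain m where m: "M = Fin m" by (cases M) (auto, metis)
  define J where "J = {j\<in>I. u j = Fin m}"
  have J: "finite J" "J \<noteq> {}" using I \<open>M \<in> u ` I\<close> m unfolding J_def by auto
  define d where "d = Max J"
  have le: "Fin m \<le> u j" for j
  proof (cases "j \<in> I")
    case True then show ?thesis using I m unfolding M_def by (metis Min_le finite_imageI imageI)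
  qed (simp add: out)
  have "u d = Fin m" using Max_in[OF J] unfolding d_def J_def by auto
  moreover have "Fin m < u j" if "j > d" for j
  proof -
    have "j \<notin> J" using that J(1) unfolding d_def by (metis Max_ge leD)
    then have "u j \<noteq> Fin m" using out[of j] unfolding J_def by auto
    with le[of j] show ?thesis by (simp add: order_less_le)
  qed
  ultimately have "gauss c F m d" using le unfolding gauss_def u_def by auto
  then show thesis by (rule that)
qed

text \<open>Gauss's lemma: in the coefficient of index \<open>d + d'\<close> every product other
  than that of the coefficients \<open>d\<close> and \<open>d'\<close> has an index beyond the
  initial form of one factor, hence a strictly larger value.\<close>

lemma gauss_mult:
  assumes F: "gauss c F m d" and G: "gauss c G m' d'"
  shows "gauss c (F * G) (m + m') (d + d')"
proof -
  define u where "u F i = V (coeff F i) + Fin (gmul i c)" for F i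
  have split: "V (coeff F i * coeff G (k - i)) + Fin (gmul k c) = u F i + u G (k - i)"
    if "i \<le> k" for i k
  proof -
    have "gmul k c = gmul i c + gmul (k - i) c" using that by (simp flip: gmul_add)
    then show ?thesis unfolding u_def V_mult
      by (cases "V (coeff F i)"; cases "V (coeff G (k - i))") (auto simp: ac_simps)
  qed
  have Fu: "Fin m \<le> u F i" "u F d = Fin m" "i > d \<Longrightarrow> Fin m < u F i" for i
    using F unfolding gauss_def u_def by auto
  have Gu: "Fin m' \<le> u G i" "u G d' = Fin m'" "i > d' \<Longrightarrow> Fin m' < u G i" for i
    using G unfolding gauss_def u_def by auto
  have strict: "Fin (m + m') < V (coeff F i * coeff G (k - i)) + Fin (gmul k c)"
    if "i \<le> k" "i > d \<or> k - i > d'" for i k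
    using that(2) unfolding split[OF that(1)]
    by (auto intro: Fin_add_less_le_mono Fin_add_le_less_mono Fu Gu)
  show ?thesis unfolding gauss_def coeff_mult
  proof (intro conjI allI impI)
    fix k
    show "Fin (m + m') \<le> V (\<Sum>i\<le>k. coeff F i * coeff G (k - i)) + Fin (gmul k c)"
      unfolding Fin_shift
      by (rule V_sum_ge) (auto simp: Fin_shift(1)[symmetric] split intro: Fin_add_mono Fu Gu)
    show "Fin (m + m') < V (\<Sum>i\<le>k. coeff F i * coeff G (k - i)) + Fin (gmul k c)"
      if "d + d' < k"
      unfolding Fin_shift
      by (rule V_sum_gt, unfold Fin_shift(2)[symmetric], rule strict) (use that in auto)
  next
    show "V (\<Sum>i\<le>d + d'. coeff F i * coeff G (d + d' - i)) + Fin (gmul (d + d') c) = Fin (m + m')"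
      unfolding Fin_shift
    proof (rule V_sum_eq[where i = d])
      show "V (coeff F d * coeff G (d + d' - d)) = Fin (m + m' - gmul (d + d') c)"
        using split[of d "d + d'"] Fu(2) Gu(2) by (simp add: Fin_shift(3)[symmetric])
      fix j assume "j \<in> {..d + d'}" "j \<noteq> d"
      then show "Fin (m + m' - gmul (d + d') c) < V (coeff F j * coeff G (d + d' - j))"
        unfolding Fin_shift(2)[symmetric] by (intro strict) auto
    qed auto
  qed
qed

lemma gauss_1: "gauss c 1 0 0"
  by (auto simp: gauss_def simp flip: one_pCons)

lemma gauss_power:
  assumes "gauss c F m d"
  shows "gauss c (F ^ n) (gmul n m) (n * d)"
  by (induction n) (use gauss_1 gauss_mult[OF assms] in auto)

text \<open>Initial forms of pairwise distinct degrees do not cancel.\<close>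
lemma gauss_sum:
  assumes "finite I" "i\<^sub>0 \<in> I" "gauss c (F i\<^sub>0) m (e i\<^sub>0)"
    and "\<And>i. i \<in> I \<Longrightarrow> i \<noteq> i\<^sub>0 \<Longrightarrow> F i = 0 \<or>
           (\<exists>m'. gauss c (F i) m' (e i) \<and> (m < m' \<or> m = m' \<and> e i < e i\<^sub>0))"
  shows "gauss c (sum F I) m (e i\<^sub>0)"
proof -
  have A: "Fin m \<le> V (coeff (F i) k) + Fin (gmul k c) \<and>
           (k > e i\<^sub>0 \<or> k = e i\<^sub>0 \<and> i \<noteq> i\<^sub>0 \<longrightarrow> Fin m < V (coeff (F i) k) + Fin (gmul k c))"
    if i: "i \<in> I" for i k
  proof (cases "i = i\<^sub>0")
    case True then show ?thesis using assms(3) unfolding gauss_def by auto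
  next
    case False
    consider "F i = 0" | m' where "gauss c (F i) m' (e i)" "m < m'"
      | "gauss c (F i) m (e i)" "e i < e i\<^sub>0"
      using assms(4)[OF i False] by auto
    then show ?thesis
    proof cases
      case 2
      then have "Fin m < Fin m'" "Fin m' \<le> V (coeff (F i) k) + Fin (gmul k c)"
        unfolding gauss_def by auto
      then show ?thesis by (meson order.strict_trans2 less_imp_le)
    qed (auto simp: gauss_def)
  qed
  show ?thesis unfolding gauss_def coeff_sum
  proof (intro conjI allI impI)
    fix k
    show "Fin m \<le> V (\<Sum>i\<in>I. coeff (F i) k) + Fin (gmul k c)"
      unfolding Fin_shift by (rule V_sum_ge) (use A in \<open>auto simp: Fin_shift\<close>)
    show "Fin m < V (\<Sum>i\<in>I. coeff (F i) k) + Fin (gmul k c)" if "e i\<^sub>0 < k"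
      unfolding Fin_shift by (rule V_sum_gt) (use A that in \<open>auto simp: Fin_shift\<close>)
  next
    show "V (\<Sum>i\<in>I. coeff (F i) (e i\<^sub>0)) + Fin (gmul (e i\<^sub>0) c) = Fin m"
      unfolding Fin_shift
    proof (rule V_sum_eq[OF assms(1,2)])
      show "V (coeff (F i\<^sub>0) (e i\<^sub>0)) = Fin (m - gmul (e i\<^sub>0) c)"
        using assms(3) unfolding gauss_def Fin_shift by auto
    qed (use A in \<open>auto simp: Fin_shift\<close>)
  qed
qed

end

section \<open>Hasse derivatives as coefficients of the Taylor expansion\<close>

lemma coeff_hasse_deriv: "coeff (hasse_deriv b f) k = of_nat ((k + b) choose b) * coeff f (k + b)"
proof -
  have "coeff (hasse_deriv b f) k =
        (\<Sum>i\<in>{b..degree f}. if i = k + b then of_nat (i choose b) * coeff f i else 0)"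
    unfolding hasse_deriv_def coeff_sum by (intro sum.cong) auto
  also have "\<dots> = of_nat ((k + b) choose b) * coeff f (k + b)"
    by (auto simp: coeff_eq_0)
  finally show ?thesis .
qed

text \<open>This is f(x + y) as a polynomial in y over K[x]: the coefficients of \<open>f\<close>
  become constants of K[x], and \<open>[:[:0, 1:], 1:]\<close> is x + y.\<close>

definition taylor :: "'a::field poly \<Rightarrow> 'a poly poly" where
  "taylor f = map_poly (\<lambda>c. [:c:]) f \<circ>\<^sub>p [:[:0, 1:], 1:]"

lemma taylor_0 [simp]: "taylor 0 = 0"
  by (simp add: taylor_def)

lemma taylor_pCons: "taylor (pCons a p) = [:[:a:]:] + [:[:0, 1:], 1:] * taylor p"
  by (simp add: taylor_def map_poly_pCons pcompose_pCons)

lemma taylor_add: "taylor (p + q) = taylor p + taylor q"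
proof (induction p q rule: poly_induct2)
  case (pCons a p b q)
  have *: "[:[:a + b:]:] = [:[:a:]:] + [:[:b:]:]" by simp
  show ?case
    unfolding add_pCons[of a p b q] taylor_pCons pCons.IH distrib_left * by (simp only: ac_simps)
qed simp

lemma taylor_smult: "taylor (smult a p) = smult [:a:] (taylor p)"
  by (induction p) (simp_all add: taylor_pCons smult_add_right mult_smult_right del: mult_pCons_left)

lemma taylor_mult: "taylor (p * q) = taylor p * taylor q"
proof (induction p)
  case (pCons a p)
  have "taylor (pCons a p * q) = smult [:a:] (taylor q) + [:[:0, 1:], 1:] * taylor (p * q)"
    unfolding mult_pCons_left[of a p q] taylor_add taylor_smult taylor_pCons[of 0]
    by (simp del: mult_pCons_left)
  also have "\<dots> = taylor (pCons a p) * taylor q"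
    unfolding pCons.IH taylor_pCons distrib_right mult.assoc by simp
  finally show ?case .
qed simp

lemma taylor_1 [simp]: "taylor 1 = 1"
  by (simp add: one_pCons taylor_pCons)

lemma taylor_power: "taylor (p ^ n) = taylor p ^ n"
  by (induction n) (simp_all add: taylor_mult)

lemma taylor_sum: "taylor (sum f I) = (\<Sum>i\<in>I. taylor (f i))"
  by (induction I rule: infinite_finite_induct) (simp_all add: taylor_add)

text \<open>For f = a + x p the expansion is a + (x + y) p(x + y). Its coefficient at index d + 1 is
  therefore x times the derivative of \<open>p\<close> of order d + 1, plus the one of order d;
  Pascal's rule identifies this with the derivative of \<open>f\<close>.\<close>

lemma coeff_taylor: "coeff (taylor f) b = hasse_deriv b f"
proof (induction f arbitrary: b)
  case 0
  show ?case by (rule poly_eqI) (simp add: coeff_hasse_deriv)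
next
  case (pCons a p)
  show ?case
  proof (cases b)
    case 0
    have "coeff (taylor (pCons a p)) 0 = pCons a (hasse_deriv 0 p)"
      by (simp add: taylor_pCons pCons.IH)
    also have "\<dots> = hasse_deriv 0 (pCons a p)"
      by (rule poly_eqI) (simp add: coeff_hasse_deriv coeff_pCons split: nat.split)
    finally show ?thesis using 0 by simp
  next
    case (Suc d)
    have "coeff (taylor (pCons a p)) (Suc d) = pCons 0 (hasse_deriv (Suc d) p) + hasse_deriv d p"
      by (simp add: taylor_pCons pCons.IH)
    also have "\<dots> = hasse_deriv (Suc d) (pCons a p)"
    proof (rule poly_eqI)
      fix k
      show "coeff (pCons 0 (hasse_deriv (Suc d) p) + hasse_deriv d p) k =
            coeff (hasse_deriv (Suc d) (pCons a p)) k"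
        by (cases k) (simp_all add: coeff_hasse_deriv distrib_right)
    qed
    finally show ?thesis using Suc by simp
  qed
qed

lemma hasse_deriv_0 [simp]: "hasse_deriv 0 f = f"
  by (rule poly_eqI) (simp add: coeff_hasse_deriv)

section \<open>The order on values of \<epsilon> and scaled valuations\<close>

lemma eps_le_refl [simp]: "eps_le e e"
  by (cases e) auto

lemma eps_le_total: "eps_le e e' \<or> eps_le e' e"
  by (cases e; cases e') auto

text \<open>Candidates with denominator \<open>0\<close> would break transitivity.\<close>
fun eps_proper :: "'g epsval \<Rightarrow> bool" where
  "eps_proper (EQ x b) \<longleftrightarrow> 0 < b"
| "eps_proper e \<longleftrightarrow> True"

text \<open>For fractions, both inequalities are multiplied by the missing denominators; the middle
  denominator is then cancelled, which uses that it is positive.\<close>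

lemma eps_le_trans:
  fixes e :: "'g::linordered_ab_group_add epsval"
  assumes "eps_le e e'" "eps_le e' e''" "eps_proper e'"
  shows "eps_le e e''"
proof (cases "\<exists>x b y c z d. e = EQ x b \<and> e' = EQ y c \<and> e'' = EQ z d")
  case True
  then obtain x b y c z d where [simp]: "e = EQ x b" "e' = EQ y c" "e'' = EQ z d" by blast
  have "gmul d (gmul c x) \<le> gmul d (gmul b y)" "gmul b (gmul d y) \<le> gmul b (gmul c z)"
    using assms by (auto intro: gmul_mono)
  then have "gmul c (gmul d x) \<le> gmul c (gmul b z)"
    by (metis gmul_commute order_trans)
  then show ?thesis using assms(3) by (simp add: gmul_le_iff)
next
  case False
  then show ?thesis using assms by (cases e; cases e'; cases e'') auto
qed

lemma eps_max_ex:
  fixes C :: "'g::linordered_ab_group_add epsval set"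
  assumes "finite C" "C \<noteq> {}" "\<And>e. e \<in> C \<Longrightarrow> eps_proper e"
  shows "\<exists>e\<in>C. \<forall>e'\<in>C. eps_le e' e"
  using assms
proof (induction C rule: finite_ne_induct)
  case (insert x C)
  then obtain e where e: "e \<in> C" "\<forall>e'\<in>C. eps_le e' e" by (metis insertI2)
  show ?case
  proof (cases "eps_le x e")
    case False
    then have "eps_le e x" using eps_le_total by blast
    moreover have "eps_proper e" using e(1) insert.prems by simp
    ultimately have "\<forall>e'\<in>C. eps_le e' x" using e(2) by (blast intro: eps_le_trans)
    then show ?thesis by simp
  qed (use e in auto)
qed auto

text \<open>For \<epsilon> = \<gamma>/b the valuation is multiplied by \<open>b\<close>, so that the
  variable of the Gauss extension gets the value \<gamma> and all values remain in \<Gamma>.\<close>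

definition scale_value :: "nat \<Rightarrow> 'g::ab_group_add extended \<Rightarrow> 'g extended" where
  "scale_value n x = (case x of Fin a \<Rightarrow> Fin (gmul n a) | Pinf \<Rightarrow> Pinf | Minf \<Rightarrow> Minf)"

lemma scale_value_simps [simp]:
  "scale_value n (Fin a) = Fin (gmul n a)" "scale_value n Pinf = Pinf" "scale_value n Minf = Minf"
  by (simp_all add: scale_value_def)

lemma scale_value_le_iff:
  fixes x :: "'g::linordered_ab_group_add extended"
  shows "0 < n \<Longrightarrow> scale_value n x \<le> scale_value n y \<longleftrightarrow> x \<le> y"
  by (cases x; cases y) (auto simp: gmul_le_iff)

lemma scale_value_less_iff:
  fixes x :: "'g::linordered_ab_group_add extended"
  shows "0 < n \<Longrightarrow> scale_value n x < scale_value n y \<longleftrightarrow> x < y"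
  by (metis not_le scale_value_le_iff)

lemma gen_valuation_scale:
  assumes "gen_valuation V" "0 < n"
  shows "gen_valuation (\<lambda>f. scale_value n (V f))"
proof -
  interpret gen_valuation V by fact
  show ?thesis
  proof
    fix a b
    show "scale_value n (V a) \<noteq> Minf" by (cases "V a"; use V_not_Minf in force)
    show "scale_value n (V (a * b)) = scale_value n (V a) + scale_value n (V b)"
      by (cases "V a"; cases "V b") (auto simp: V_mult gmul_plus)
    show "min (scale_value n (V a)) (scale_value n (V b)) \<le> scale_value n (V (a + b))"
      using V_add[of a b] assms(2) by (auto simp: min_def scale_value_le_iff)
  qed simp_all
qed

section \<open>Expansions in powers of q and linear dependence of polynomials\<close>

lemma poly_div_pow_Suc:
  fixes f q :: "'a::field poly"
  shows "f div q ^ Suc i = f div q ^ i div q"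
  by (simp only: power_Suc2 poly_div_mult_right)

text \<open>Repeated division by \<open>q\<close> leaves the rest
  \<open>(h div q ^ n) * q ^ n\<close> after \<open>n\<close> steps; it vanishes for
  \<open>n = degree h + 1\<close> because \<open>q\<close> is nonconstant.\<close>

lemma qexp_sum:
  fixes h q :: "'a::field poly"
  assumes "0 < degree q"
  shows "h = (\<Sum>i\<le>degree h. qexp_coeff q h i * q ^ i)"
proof -
  have "h = (\<Sum>i<n. qexp_coeff q h i * q ^ i) + (h div q ^ n) * q ^ n" for n
  proof (induction n)
    case (Suc n)
    have "(h div q ^ n) * q ^ n = (h div q ^ n div q * q + h div q ^ n mod q) * q ^ n" by simp
    also have "\<dots> = qexp_coeff q h n * q ^ n + (h div q ^ Suc n) * q ^ Suc n"
      unfolding qexp_coeff_def poly_div_pow_Suc unfolding power_Suc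
      by (simp only: distrib_left distrib_right ac_simps)
    finally show ?case using Suc.IH by (simp add: ac_simps)
  qed simp
  moreover have "h div q ^ Suc (degree h) = 0"
  proof (rule div_poly_less)
    have "q \<noteq> 0" using assms by auto
    then have "degree (q ^ Suc (degree h)) = Suc (degree h) * degree q" by (rule degree_power_eq)
    also have "\<dots> \<ge> Suc (degree h)" using assms mult_le_mono2[of 1 "degree q" "Suc (degree h)"] by simp
    finally show "degree h < degree (q ^ Suc (degree h))" by simp
  qed
  ultimately show ?thesis by (metis (no_types, lifting) add.right_neutral lessThan_Suc_atMost mult_zero_left)
qed

lemma degree_qexp_coeff: "0 < degree q \<Longrightarrow> degree (qexp_coeff q h i) < degree q"
  by (metis qexp_coeff_def degree_mod_less degree_0 less_numeral_extra(3))

text \<open>P(q) is its own \<open>q\<close>-expansion, since constants have degree below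
  \<open>degree q\<close>. This later gives access to the truncated value of polynomials in Q over
  K.\<close>

lemma qexp_coeff_pcompose:
  fixes P q :: "'a::field poly"
  assumes "0 < degree q"
  shows "qexp_coeff q (pcompose P q) i = [:coeff P i:]"
proof (induction P arbitrary: i)
  case (pCons a P)
  have q: "q \<noteq> 0" using assms by auto
  have d: "([:a:] + q * pcompose P q) div q = pcompose P q"
    using q assms by (simp add: div_poly_less)
  show ?case
  proof (cases i)
    case 0
    then show ?thesis using assms by (simp add: qexp_coeff_def pcompose_pCons mod_poly_less)
  next
    case (Suc j)
    have "pcompose (pCons a P) q div q ^ i = pcompose P q div q ^ j"
      using d by (simp add: Suc pcompose_pCons poly_div_mult_right)
    then show ?thesis using pCons.IH[of j] by (simp add: qexp_coeff_def Suc)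
  qed
qed (simp add: qexp_coeff_def)

text \<open>Gaussian elimination on the coefficient of index \<open>n\<close>. The degree bound is
  phrased by vanishing coefficients, so that \<open>n = 0\<close> means that all members are
  zero.\<close>

lemma poly_family_dependent:
  fixes r :: "'i \<Rightarrow> 'a::field poly"
  assumes "finite I" "n < card I" "\<And>i k. i \<in> I \<Longrightarrow> n \<le> k \<Longrightarrow> coeff (r i) k = 0"
  shows "\<exists>c. (\<exists>i\<in>I. c i \<noteq> 0) \<and> (\<Sum>i\<in>I. smult (c i) (r i)) = 0"
  using assms
proof (induction n arbitrary: I r)
  case 0
  then obtain i where i: "i \<in> I" by fastforce
  have "r i = 0" if "i \<in> I" for i by (rule poly_eqI) (use 0 that in auto)
  then show ?case using i by (intro exI[of _ "\<lambda>_. 1"]) auto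
next
  case (Suc n)
  show ?case
  proof (cases "\<forall>i\<in>I. coeff (r i) n = 0")
    case True
    then have "coeff (r i) k = 0" if "i \<in> I" "n \<le> k" for i k
      using Suc.prems(3)[of i k] that by (cases "k = n") auto
    then show ?thesis using Suc.prems by (intro Suc.IH) auto
  next
    case False
    then obtain j where j: "j \<in> I" "coeff (r j) n \<noteq> 0" by auto
    define a where "a i = coeff (r i) n / coeff (r j) n" for i
    define s where "s i = r i - smult (a i) (r j)" for i
    have "\<exists>c. (\<exists>i\<in>I-{j}. c i \<noteq> 0) \<and> (\<Sum>i\<in>I-{j}. smult (c i) (s i)) = 0"
    proof (rule Suc.IH)
      show "n < card (I - {j})" using Suc.prems j by simp
      fix i k assume "i \<in> I - {j}" "n \<le> k"
      then show "coeff (s i) k = 0" using j Suc.prems(3)[of i k] Suc.prems(3)[of j k]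
        by (cases "k = n") (auto simp: s_def a_def)
    qed (use Suc.prems in auto)
    then obtain c where c: "\<exists>i\<in>I-{j}. c i \<noteq> 0" "(\<Sum>i\<in>I-{j}. smult (c i) (s i)) = 0" by auto
    \<comment> \<open>The pivot's coefficient compensates the multiples of \<open>r j\<close> that
      were subtracted in \<open>s\<close>.\<close>
    define c' where "c' = c(j := - (\<Sum>i\<in>I-{j}. c i * a i))"
    have "(\<Sum>i\<in>I. smult (c' i) (r i)) = smult (c' j) (r j) + (\<Sum>i\<in>I-{j}. smult (c i) (r i))"
      using j Suc.prems(1) by (simp add: sum.remove c'_def)
    also have "\<dots> = (\<Sum>i\<in>I-{j}. smult (c i) (s i))"
      by (simp add: s_def c'_def smult_diff_right sum_subtractf smult_sum)
    finally show ?thesis using c by (intro exI[of _ c']) (auto simp: c'_def)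
  qed
qed

section \<open>Initial forms of Taylor expansions\<close>

context
  fixes V :: "'a::field poly \<Rightarrow> 'g::linordered_ab_group_add extended" and c :: 'g
  assumes V: "gen_valuation V" and V_Pinf: "\<And>f. V f = Pinf \<longleftrightarrow> f = 0"
begin

interpretation gen_valuation V by (rule V)

lemma V_Fin: "f \<noteq> 0 \<Longrightarrow> \<exists>m. V f = Fin m"
  using V_Pinf[of f] V_not_Minf[of f] by (cases "V f") auto

lemma gauss_taylor_ex:
  assumes "f \<noteq> 0"
  obtains m d where "gauss c (taylor f) m d"
  using gauss_ex[of "taylor f" 0] assms V_Pinf by (auto simp: coeff_taylor)

lemma gauss_taylor_0:
  assumes "gauss c (taylor f) m 0"
  shows "V f = Fin m"
  using assms unfolding gauss_def coeff_taylor by (cases "V f") auto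

text \<open>With \<open>V\<close> the \<open>b\<close>-fold of \<nu> and \<open>c\<close> =
  \<gamma>, the right-hand side is the condition \<epsilon>(f) < \<gamma>/b.\<close>

lemma gauss_taylor_0_iff:
  assumes "f \<noteq> 0"
  shows "(\<exists>m. gauss c (taylor f) m 0) \<longleftrightarrow> (\<forall>i>0. V f < V (hasse_deriv i f) + Fin (gmul i c))"
proof -
  obtain m where m: "V f = Fin m" using V_Fin assms by blast
  have "gauss c (taylor f) m 0" if *: "\<forall>i>0. V f < V (hasse_deriv i f) + Fin (gmul i c)"
    unfolding gauss_def coeff_taylor
  proof (intro conjI allI impI)
    fix i show "Fin m \<le> V (hasse_deriv i f) + Fin (gmul i c)"
      using * m by (cases "i = 0") (auto intro: less_imp_le)
  qed (use * m in auto)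
  moreover have "V f < V (hasse_deriv i f) + Fin (gmul i c)"
    if "gauss c (taylor f) m' 0" "0 < i" for m' i
    using that gauss_taylor_0[OF that(1)] unfolding gauss_def coeff_taylor by auto
  ultimately show ?thesis by blast
qed

text \<open>Degrees of initial forms add under multiplication, so degree 0 for the product forces
  degree 0 for both factors.\<close>

lemma gauss_taylor_mult_0:
  assumes "gauss c (taylor (f * g)) m 0" "f \<noteq> 0" "g \<noteq> 0"
  shows "(\<exists>m. gauss c (taylor f) m 0) \<and> (\<exists>m. gauss c (taylor g) m 0)"
proof -
  obtain m1 d1 m2 d2 where *: "gauss c (taylor f) m1 d1" "gauss c (taylor g) m2 d2"
    using gauss_taylor_ex assms by metis
  have "gauss c (taylor (f * g)) (m1 + m2) (d1 + d2)"
    unfolding taylor_mult by (rule gauss_mult) fact+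
  then have "d1 + d2 = 0" using gauss_unique(2)[OF assms(1)] by metis
  then show ?thesis using * by auto
qed

text \<open>Terms of the \<open>q\<close>-expansion have initial forms of distinct degrees \<open>i * D\<close> in the Taylor variable.\<close>
lemma gauss_taylor_expansion:
  assumes q: "0 < degree q" "gauss c (taylor q) k D" "0 < D" "V q = Fin k"
    and less: "\<forall>r. r \<noteq> 0 \<and> degree r < degree q \<longrightarrow> (\<exists>m. gauss c (taylor r) m 0)"
    and h: "h \<noteq> 0"
  obtains i\<^sub>0 m where "gauss c (taylor h) m (i\<^sub>0 * D)" "i\<^sub>0 \<le> degree h"
    "V (qexp_coeff q h i\<^sub>0 * q ^ i\<^sub>0) = Fin m"
    "\<And>i. Fin m \<le> V (qexp_coeff q h i * q ^ i)"
    "\<And>i. i\<^sub>0 < i \<Longrightarrow> Fin m < V (qexp_coeff q h i * q ^ i)"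
proof -
  define t where "t i = qexp_coeff q h i * q ^ i" for i
  have sum: "h = sum t {..degree h}" unfolding t_def by (rule qexp_sum) fact
  have out: "t i = 0" if "degree h < i" for i
  proof -
    have "degree (q ^ i) = i * degree q" using q(1) by (subst degree_power_eq) auto
    moreover have "i \<le> i * degree q" using q(1) by simp
    ultimately have "degree h < degree (q ^ i)" using that by linarith
    then show ?thesis by (simp add: t_def qexp_coeff_def div_poly_less)
  qed
  \<comment> \<open>The coefficient has degree below \<open>degree q\<close>, so its initial form
    has degree 0, and \<open>q ^ i\<close> contributes the degree \<open>i * D\<close>.\<close>
  have term_gauss: "\<exists>m. V (t i) = Fin m \<and> gauss c (taylor (t i)) m (i * D)" if "t i \<noteq> 0" for i
  proof -
    have "qexp_coeff q h i \<noteq> 0" using that unfolding t_def by auto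
    then obtain m where m: "gauss c (taylor (qexp_coeff q h i)) m 0"
      using less degree_qexp_coeff[OF q(1)] by blast
    have "gauss c (taylor (t i)) (m + gmul i k) (0 + i * D)"
      unfolding t_def taylor_mult taylor_power by (intro gauss_mult m gauss_power q)
    moreover have "V (t i) = Fin (m + gmul i k)"
      using gauss_taylor_0[OF m] q(4) unfolding t_def V_mult V_power by auto
    ultimately show ?thesis by auto
  qed
  define I where "I = {i. i \<le> degree h \<and> t i \<noteq> 0}"
  have I: "finite I" unfolding I_def by auto
  have "I \<noteq> {}"
  proof
    assume "I = {}"
    then have "sum t {..degree h} = 0" unfolding I_def by (intro sum.neutral) auto
    then show False using sum h by simp
  qed
  have tI: "t i \<noteq> 0 \<longleftrightarrow> i \<in> I" for i using out[of i] unfolding I_def by (cases "i \<le> degree h") auto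
  define M where "M = Min ((V \<circ> t) ` I)"
  have "M \<in> (V \<circ> t) ` I" unfolding M_def using I \<open>I \<noteq> {}\<close> by (intro Min_in) auto
  then obtain j where j: "j \<in> I" "M = V (t j)" by auto
  obtain m where "V (t j) = Fin m" using term_gauss[of j] j(1) tI[of j] by blast
  with j(2) have m: "M = Fin m" by simp
  have Mle: "Fin m \<le> V (t i)" for i
  proof (cases "i \<in> I")
    case True
    then show ?thesis using I unfolding m[symmetric] M_def by (intro Min_le) auto
  next
    case False then show ?thesis using tI[of i] V_Pinf[of "t i"] by auto
  qed
  define J where "J = {i\<in>I. V (t i) = Fin m}"
  have J: "finite J" "J \<noteq> {}" using I j m unfolding J_def by auto
  \<comment> \<open>Among the terms of least value, the one with the largest index has the initial
    form of largest degree, because \<open>D\<close> is positive; it governs the sum.\<close>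
  define i\<^sub>0 where "i\<^sub>0 = Max J"
  have i0: "i\<^sub>0 \<in> I" "V (t i\<^sub>0) = Fin m" using Max_in[OF J] unfolding i\<^sub>0_def J_def by auto
  have strict: "Fin m < V (t i)" if "i\<^sub>0 < i" for i
  proof -
    have "i \<notin> J" using that J(1) unfolding i\<^sub>0_def by (metis Max_ge leD)
    then have "V (t i) \<noteq> Fin m"
      using tI[of i] V_Pinf[of "t i"] unfolding J_def by (cases "i \<in> I") auto
    with Mle[of i] show ?thesis by (simp add: order_less_le)
  qed
  have "gauss c (sum (\<lambda>i. taylor (t i)) {..degree h}) m (i\<^sub>0 * D)"
  proof (rule gauss_sum[where F = "\<lambda>i. taylor (t i)" and e = "\<lambda>i. i * D"])
    show "i\<^sub>0 \<in> {..degree h}" using i0 unfolding I_def by auto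
    obtain m' where "V (t i\<^sub>0) = Fin m'" "gauss c (taylor (t i\<^sub>0)) m' (i\<^sub>0 * D)"
      using term_gauss[of i\<^sub>0] i0(1) tI[of i\<^sub>0] by blast
    then show "gauss c (taylor (t i\<^sub>0)) m (i\<^sub>0 * D)" using i0(2) by simp
    fix i assume i: "i \<in> {..degree h}" "i \<noteq> i\<^sub>0"
    show "taylor (t i) = 0 \<or>
      (\<exists>m'. gauss c (taylor (t i)) m' (i * D) \<and> (m < m' \<or> m = m' \<and> i * D < i\<^sub>0 * D))"
    proof (cases "t i = 0")
      case False
      then obtain m' where m': "V (t i) = Fin m'" "gauss c (taylor (t i)) m' (i * D)"
        using term_gauss by blast
      have "m \<le> m'" using Mle[of i] m' by simp
      moreover have "i * D < i\<^sub>0 * D" if "m = m'"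
      proof -
        have "\<not> i\<^sub>0 < i" using strict[of i] m'(1) that by auto
        then show ?thesis using i(2) q(3) by simp
      qed
      ultimately have "m < m' \<or> m = m' \<and> i * D < i\<^sub>0 * D" by fastforce
      then show ?thesis using m'(2) by blast
    qed simp
  qed simp
  then have "gauss c (taylor h) m (i\<^sub>0 * D)"
    using arg_cong[OF sum, of taylor] by (simp only: taylor_sum)
  moreover have "i\<^sub>0 \<le> degree h" using i0 unfolding I_def by auto
  ultimately show thesis
    by (rule that[OF _ _ i0(2)[unfolded t_def] Mle[unfolded t_def] strict[unfolded t_def]])
qed

text \<open>An initial form of degree 0 means \<open>i\<^sub>0 * D = 0\<close>, so
  \<open>i\<^sub>0 = 0\<close>. All terms of the expansion except \<open>h mod q\<close> then have
  values larger than that of \<open>h\<close>.\<close>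

lemma mod_approximates:
  assumes q: "0 < degree q" "gauss c (taylor q) k D" "0 < D" "V q = Fin k"
    and less: "\<forall>r. r \<noteq> 0 \<and> degree r < degree q \<longrightarrow> (\<exists>m. gauss c (taylor r) m 0)"
    and h: "h \<noteq> 0" "gauss c (taylor h) m 0"
  shows "V h < V (h - h mod q)"
proof -
  define t where "t i = qexp_coeff q h i * q ^ i" for i
  obtain i\<^sub>0 m' where *: "gauss c (taylor h) m' (i\<^sub>0 * D)"
    "\<And>i. i\<^sub>0 < i \<Longrightarrow> Fin m' < V (t i)"
    unfolding t_def by (rule gauss_taylor_expansion[OF q less h(1)]) blast
  have eq: "m' = m" "i\<^sub>0 = 0" using gauss_unique[OF *(1) h(2)] q(3) by auto
  have "h = sum t {..degree h}" unfolding t_def by (rule qexp_sum) fact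
  also have "\<dots> = t 0 + sum t {1..degree h}"
    by (metis One_nat_def atMost_atLeast0 le0 sum.atLeast_Suc_atMost)
  finally have "h - h mod q = sum t {1..degree h}"
    by (simp add: t_def qexp_coeff_def algebra_simps)
  moreover have "Fin m < V (sum t {1..degree h})" by (rule V_sum_gt) (use * eq in auto)
  ultimately show ?thesis using gauss_taylor_0[OF h(2)] by simp
qed

end

section \<open>Krull valuations and the invariant \<epsilon>\<close>

lemma gen_valuation_if_valuation: "valuation \<nu> \<Longrightarrow> gen_valuation \<nu>"
  by unfold_locales (auto simp: valuation_def)

lemma hasse_deriv_eq_0: "degree f < b \<Longrightarrow> hasse_deriv b f = 0"
  by (rule poly_eqI) (simp add: coeff_hasse_deriv coeff_eq_0)

text \<open>The binomial coefficient in front of the leading coefficient is 1, so this holds in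
  every characteristic; it provides a candidate for \<epsilon>(f).\<close>

lemma hasse_deriv_degree_neq_0: "f \<noteq> 0 \<Longrightarrow> hasse_deriv (degree f) f \<noteq> 0"
  using coeff_hasse_deriv[of "degree f" f 0] by auto

lemma hasse_deriv_smult: "hasse_deriv b (smult a f) = smult a (hasse_deriv b f)"
  by (rule poly_eqI) (simp add: coeff_hasse_deriv)

locale krull_valuation =
  fixes \<nu> :: "'a::field poly \<Rightarrow> 'g::linordered_ab_group_add extended"
  assumes valuation: "valuation \<nu>" and krull: "krull \<nu>"
begin

sublocale gen_valuation \<nu>
  by (rule gen_valuation_if_valuation) (rule valuation)

definition val :: "'a poly \<Rightarrow> 'g" where
  "val f = fin_val (\<nu> f)"

lemma nu_Pinf_iff: "\<nu> f = Pinf \<longleftrightarrow> f = 0"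
  using krull unfolding krull_def supp_def by auto

lemma nu_val: "f \<noteq> 0 \<Longrightarrow> \<nu> f = Fin (val f)"
  using nu_Pinf_iff[of f] V_not_Minf[of f] unfolding val_def by (cases "\<nu> f") auto

lemma val_mult: "f \<noteq> 0 \<Longrightarrow> g \<noteq> 0 \<Longrightarrow> val (f * g) = val f + val g"
  using V_mult[of f g] by (simp add: nu_val)

lemma val_1 [simp]: "val 1 = 0"
  by (simp add: val_def)

lemma val_power: "f \<noteq> 0 \<Longrightarrow> val (f ^ n) = gmul n (val f)"
  by (induction n) (simp_all add: val_mult)

lemma val_smult: "a \<noteq> 0 \<Longrightarrow> f \<noteq> 0 \<Longrightarrow> val (smult a f) = val [:a:] + val f"
  using val_mult[of "[:a:]" f] by simp

lemma nu_smult: "\<nu> (smult a f) = \<nu> [:a:] + \<nu> f"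
  using V_mult[of "[:a:]" f] by simp

lemma not_generates_supp [simp]: "\<not> generates_supp \<nu> f"
proof
  assume "generates_supp \<nu> f"
  then have "f \<noteq> 0" "f * 1 \<in> supp \<nu>" unfolding generates_supp_def by blast+
  then show False using krull unfolding krull_def by simp
qed

lemma deg_lt_alpha [simp]: "deg_lt_alpha \<nu> f"
  using krull unfolding krull_def deg_lt_alpha_def by simp

lemma eps_cands_0 [simp]: "eps_cands \<nu> 0 = {}"
  by (simp add: eps_cands_def)

lemma eps_cands_const: "f \<noteq> 0 \<Longrightarrow> degree f = 0 \<Longrightarrow> eps_cands \<nu> f = {ENegInf}"
  by (simp add: eps_cands_def)

lemma eps_cands_nonconst:
  assumes "0 < degree f"
  shows "eps_cands \<nu> f = (\<lambda>i. EQ (val f - val (hasse_deriv i f)) i) `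
           {i. 1 \<le> i \<and> i \<le> degree f \<and> hasse_deriv i f \<noteq> 0}"
proof -
  have "f \<noteq> 0" using assms by auto
  with assms show ?thesis by (auto simp: eps_cands_def nu_Pinf_iff val_def)
qed

lemma eps_cands_finite: "finite (eps_cands \<nu> f)"
  by (cases "f = 0"; cases "degree f = 0") (simp_all add: eps_cands_const eps_cands_nonconst)

lemma eps_cands_nonempty:
  assumes "f \<noteq> 0"
  shows "eps_cands \<nu> f \<noteq> {}"
proof (cases "degree f = 0")
  case False
  then have "degree f \<in> {i. 1 \<le> i \<and> i \<le> degree f \<and> hasse_deriv i f \<noteq> 0}"
    using hasse_deriv_degree_neq_0[OF assms] by simp
  then show ?thesis using False by (auto simp: eps_cands_nonconst)
qed (simp add: eps_cands_const assms)

lemma eps_cands_proper: "f \<noteq> 0 \<Longrightarrow> e \<in> eps_cands \<nu> f \<Longrightarrow> eps_proper e"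
  by (cases "degree f = 0") (auto simp: eps_cands_const eps_cands_nonconst)

lemma eps_defined_iff: "eps_defined \<nu> f \<longleftrightarrow> f \<noteq> 0"
  using eps_cands_nonempty[of f] by (auto simp: eps_defined_def)

text \<open>\<open>eps_le\<close> is only a preorder, since a fraction has many representations. A
  maximal candidate need not be unique, so one is chosen.\<close>

definition eps :: "'a poly \<Rightarrow> 'g epsval" where
  "eps f = (SOME e. e \<in> eps_cands \<nu> f \<and> (\<forall>e'\<in>eps_cands \<nu> f. eps_le e' e))"

lemma eps_max:
  assumes "f \<noteq> 0"
  shows "eps f \<in> eps_cands \<nu> f" "\<And>e. e \<in> eps_cands \<nu> f \<Longrightarrow> eps_le e (eps f)"
proof -
  have "\<exists>e. e \<in> eps_cands \<nu> f \<and> (\<forall>e'\<in>eps_cands \<nu> f. eps_le e' e)"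
    using eps_max_ex[OF eps_cands_finite eps_cands_nonempty[OF assms]] eps_cands_proper[OF assms]
    by blast
  from someI_ex[OF this, folded eps_def]
  show "eps f \<in> eps_cands \<nu> f" "\<And>e. e \<in> eps_cands \<nu> f \<Longrightarrow> eps_le e (eps f)" by auto
qed

lemma eps_proper_eps: "f \<noteq> 0 \<Longrightarrow> eps_proper (eps f)"
  using eps_max(1) eps_cands_proper by blast

lemma eps_trans:
  "eps_le e (eps f) \<Longrightarrow> eps_le (eps f) e' \<Longrightarrow> f \<noteq> 0 \<Longrightarrow> eps_le e e'"
  using eps_le_trans eps_proper_eps by blast

lemma eps_const: "f \<noteq> 0 \<Longrightarrow> degree f = 0 \<Longrightarrow> eps f = ENegInf"
  using eps_max(1)[of f] by (simp add: eps_cands_const)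

lemma eps_nonconst:
  assumes "0 < degree f"
  obtains i where "0 < i" "hasse_deriv i f \<noteq> 0" "eps f = EQ (val f - val (hasse_deriv i f)) i"
proof -
  have "f \<noteq> 0" using assms by auto
  then show thesis using eps_max(1)[of f] that assms by (auto simp: eps_cands_nonconst)
qed

lemma eps_ge_iff:
  assumes "f \<noteq> 0" "g \<noteq> 0"
  shows "eps_ge \<nu> f g \<longleftrightarrow> eps_le (eps g) (eps f)"
proof
  assume "eps_ge \<nu> f g"
  then obtain e where "e \<in> eps_cands \<nu> f" "eps_le (eps g) e"
    using eps_max(1)[OF assms(2)] unfolding eps_ge_def by blast
  then show "eps_le (eps g) (eps f)"
    using eps_max(2)[OF assms(1)] eps_cands_proper[OF assms(1)] eps_le_trans by blast
next
  assume "eps_le (eps g) (eps f)"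
  then have "eps_le e (eps f)" if "e \<in> eps_cands \<nu> g" for e
    using eps_max(2)[OF assms(2) that] eps_trans assms(2) by blast
  then show "eps_ge \<nu> f g" using eps_max(1)[OF assms(1)] unfolding eps_ge_def by blast
qed

text \<open>The value of \<open>a\<close> cancels in each difference, so the candidate sets are
  equal and \<open>SOME\<close> picks the same element. This permits passing to a monic
  polynomial.\<close>

lemma eps_smult:
  assumes "a \<noteq> 0"
  shows "eps (smult a f) = eps f"
proof -
  have "eps_cands \<nu> (smult a f) = eps_cands \<nu> f"
  proof (cases "degree f = 0")
    case True
    then show ?thesis using assms by (cases "f = 0") (simp_all add: eps_cands_const)
  next
    case False
    then have "f \<noteq> 0" by auto
    have "EQ (val (smult a f) - val (hasse_deriv i (smult a f))) i = EQ (val f - val (hasse_deriv i f)) i"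
      if "hasse_deriv i f \<noteq> 0" for i
      using that assms \<open>f \<noteq> 0\<close> by (simp add: hasse_deriv_smult val_smult)
    then show ?thesis using False assms
      by (auto simp: eps_cands_nonconst hasse_deriv_smult intro!: image_cong)
  qed
  then show ?thesis by (simp add: eps_def)
qed

lemma cand_le_iff:
  assumes "f \<noteq> 0" "hasse_deriv i f \<noteq> 0"
  shows "eps_le (EQ (val f - val (hasse_deriv i f)) i) (EQ \<gamma> b) \<longleftrightarrow>
         scale_value b (\<nu> f) \<le> scale_value b (\<nu> (hasse_deriv i f)) + Fin (gmul i \<gamma>)"
  using assms by (simp add: nu_val gmul_diff algebra_simps)

lemma le_cand_iff:
  assumes "f \<noteq> 0" "hasse_deriv i f \<noteq> 0"
  shows "eps_le (EQ \<gamma> b) (EQ (val f - val (hasse_deriv i f)) i) \<longleftrightarrow>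
         scale_value b (\<nu> (hasse_deriv i f)) + Fin (gmul i \<gamma>) \<le> scale_value b (\<nu> f)"
  using assms by (simp add: nu_val gmul_diff algebra_simps)

text \<open>The maximum is bounded by \<gamma>/b iff each candidate is. The inequality is trivial
  for \<open>i = 0\<close> and for vanishing derivatives, so all \<open>i\<close> may be
  included.\<close>

lemma eps_le_iff:
  assumes "f \<noteq> 0"
  shows "eps_le (eps f) (EQ \<gamma> b) \<longleftrightarrow>
    (\<forall>i. scale_value b (\<nu> f) \<le> scale_value b (\<nu> (hasse_deriv i f)) + Fin (gmul i \<gamma>))"
    (is "_ \<longleftrightarrow> (\<forall>i. ?le i)")
proof -
  have triv: "?le i" if "hasse_deriv i f = 0 \<or> i = 0" for i
    using that assms by (auto simp: nu_val)
  show ?thesis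
  proof (cases "degree f = 0")
    case True
    then have "?le i" for i using triv[of i] hasse_deriv_eq_0[of f i] by auto
    then show ?thesis using True assms by (simp add: eps_const)
  next
    case False
    then have "0 < degree f" by simp
    show ?thesis
    proof
      assume *: "eps_le (eps f) (EQ \<gamma> b)"
      show "\<forall>i. ?le i"
      proof
        fix i
        show "?le i"
        proof (cases "hasse_deriv i f = 0 \<or> i = 0")
          case False
          then have "EQ (val f - val (hasse_deriv i f)) i \<in> eps_cands \<nu> f"
            using \<open>0 < degree f\<close> hasse_deriv_eq_0[of f i]
            by (auto simp: eps_cands_nonconst linorder_not_less[symmetric])
          then have "eps_le (EQ (val f - val (hasse_deriv i f)) i) (EQ \<gamma> b)"
            using * eps_max(2)[OF assms] eps_trans[OF _ _ assms] by blast
          then show ?thesis using cand_le_iff assms False by blast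
        qed (rule triv)
      qed
    next
      assume *: "\<forall>i. ?le i"
      obtain i where "hasse_deriv i f \<noteq> 0" "eps f = EQ (val f - val (hasse_deriv i f)) i"
        using eps_nonconst[OF \<open>0 < degree f\<close>] by metis
      then show "eps_le (eps f) (EQ \<gamma> b)" using * cand_le_iff[OF assms] by metis
    qed
  qed
qed

text \<open>As in \<open>eps_le_iff\<close>, but the strict inequality fails at
  \<open>i = 0\<close>, so that index is left out.\<close>

lemma eps_less_iff:
  assumes "f \<noteq> 0" "0 < b"
  shows "\<not> eps_le (EQ \<gamma> b) (eps f) \<longleftrightarrow>
    (\<forall>i>0. scale_value b (\<nu> f) < scale_value b (\<nu> (hasse_deriv i f)) + Fin (gmul i \<gamma>))"
    (is "_ \<longleftrightarrow> (\<forall>i>0. ?lt i)")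
proof -
  have triv: "?lt i" if "hasse_deriv i f = 0" for i
    using that assms by (auto simp: nu_val)
  show ?thesis
  proof (cases "degree f = 0")
    case True
    then have "?lt i" if "i > 0" for i using triv[of i] hasse_deriv_eq_0[of f i] that by auto
    then show ?thesis using True assms by (simp add: eps_const)
  next
    case False
    then have "0 < degree f" by simp
    show ?thesis
    proof
      assume *: "\<not> eps_le (EQ \<gamma> b) (eps f)"
      show "\<forall>i>0. ?lt i"
      proof (intro allI impI)
        fix i :: nat assume "0 < i"
        show "?lt i"
        proof (cases "hasse_deriv i f = 0")
          case False
          then have c: "EQ (val f - val (hasse_deriv i f)) i \<in> eps_cands \<nu> f"
            using \<open>0 < degree f\<close> \<open>0 < i\<close> hasse_deriv_eq_0[of f i]
            by (auto simp: eps_cands_nonconst linorder_not_less[symmetric])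
          have "\<not> eps_le (EQ \<gamma> b) (EQ (val f - val (hasse_deriv i f)) i)"
            using * eps_max(2)[OF assms(1) c] eps_le_trans eps_cands_proper[OF assms(1) c] by blast
          then show ?thesis using le_cand_iff[OF assms(1) False] by (metis linorder_not_less)
        qed (rule triv)
      qed
    next
      assume *: "\<forall>i>0. ?lt i"
      obtain i where "hasse_deriv i f \<noteq> 0" "0 < i" "eps f = EQ (val f - val (hasse_deriv i f)) i"
        using eps_nonconst[OF \<open>0 < degree f\<close>] by metis
      then show "\<not> eps_le (EQ \<gamma> b) (eps f)"
        using * le_cand_iff[OF assms(1)] by (metis linorder_not_less)
    qed
  qed
qed

lemma gen_valuation_nu_scale: "0 < b \<Longrightarrow> gen_valuation (\<lambda>f. scale_value b (\<nu> f))"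
  by (rule gen_valuation_scale) unfold_locales

lemma scale_nu_Pinf_iff: "scale_value b (\<nu> f) = Pinf \<longleftrightarrow> f = 0"
  by (cases "f = 0") (simp_all add: nu_val)

text \<open>For \<gamma>/b = \<epsilon>(q) no term of the Taylor expansion lies below the value of
  \<open>q\<close>, and the positive index that realises \<epsilon>(q) gives equality. Hence
  \<open>D\<close> is at least this index.\<close>

lemma gauss_attained:
  assumes "0 < degree q" "eps q = EQ \<gamma> b" "0 < b"
  obtains k D where "gen_valuation.gauss (\<lambda>f. scale_value b (\<nu> f)) \<gamma> (taylor q) k D"
    "0 < D" "scale_value b (\<nu> q) = Fin k"
proof -
  interpret S: gen_valuation "\<lambda>f. scale_value b (\<nu> f)"
    by (rule gen_valuation_nu_scale) fact
  have q: "q \<noteq> 0" using assms(1) by auto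
  obtain k D where kD: "S.gauss \<gamma> (taylor q) k D"
    using gauss_taylor_ex[OF S.gen_valuation_axioms scale_nu_Pinf_iff q] by metis
  have le: "scale_value b (\<nu> q) \<le> scale_value b (\<nu> (hasse_deriv i q)) + Fin (gmul i \<gamma>)" for i
    using eps_le_iff[OF q, of \<gamma> b] assms(2) by simp
  obtain i where i: "hasse_deriv i q \<noteq> 0" "0 < i" "eps q = EQ (val q - val (hasse_deriv i q)) i"
    using eps_nonconst[OF assms(1)] by metis
  have "eps_le (EQ \<gamma> b) (EQ (val q - val (hasse_deriv i q)) i)"
    using i(3) assms(2) by (metis eps_le_refl)
  then have i_le: "scale_value b (\<nu> (hasse_deriv i q)) + Fin (gmul i \<gamma>) \<le> scale_value b (\<nu> q)"
    using le_cand_iff[OF q i(1)] by blast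
  have k: "scale_value b (\<nu> q) = Fin k"
  proof (rule antisym)
    show "scale_value b (\<nu> q) \<le> Fin k"
      using le[of D] kD unfolding S.gauss_def coeff_taylor by metis
    have "Fin k \<le> scale_value b (\<nu> (hasse_deriv 0 q)) + Fin (gmul 0 \<gamma>)"
      using kD unfolding S.gauss_def coeff_taylor by metis
    then show "Fin k \<le> scale_value b (\<nu> q)" using q by (simp add: nu_val)
  qed
  have "\<not> D < i"
  proof
    assume "D < i"
    then have "Fin k < scale_value b (\<nu> (hasse_deriv i q)) + Fin (gmul i \<gamma>)"
      using kD unfolding S.gauss_def coeff_taylor by metis
    with i_le k show False by (metis leD)
  qed
  then show thesis using that kD k i(2) by simp
qed

lemma gauss_below:
  assumes "f \<noteq> 0" "0 < b" "\<not> eps_le (EQ \<gamma> b) (eps f)"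
  shows "\<exists>m. gen_valuation.gauss (\<lambda>f. scale_value b (\<nu> f)) \<gamma> (taylor f) m 0"
  using gauss_taylor_0_iff[OF gen_valuation_nu_scale[OF assms(2)] scale_nu_Pinf_iff assms(1)]
    eps_less_iff[OF assms(1,2)] assms(3) by blast

section \<open>Truncations and relations modulo a polynomial with minimality in degree\<close>

text \<open>For nonzero \<open>q\<close> this is the contrapositive of the key polynomial condition,
  with \<open>q\<close> not necessarily monic.\<close>

definition eps_below :: "'a poly \<Rightarrow> bool" where
  "eps_below q \<longleftrightarrow> (\<forall>r. r \<noteq> 0 \<and> degree r < degree q \<longrightarrow> \<not> eps_le (eps q) (eps r))"

text \<open>Both sides, scaled by \<open>b\<close>, equal the Gauss value of the Taylor expansion of
  \<open>h\<close>: the left one because \<epsilon>(h) is at most \<epsilon>(q), the right one by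
  \<open>gauss_taylor_expansion\<close>.\<close>

lemma nu_eq_truncation:
  assumes q: "0 < degree q" "eps_below q" and max: "\<And>f. f \<noteq> 0 \<Longrightarrow> eps_le (eps f) (eps q)"
  shows "\<nu> h = truncation \<nu> q h"
proof (cases "h = 0")
  case True
  then show ?thesis by (simp add: truncation_def qexp_coeff_def)
next
  case h: False
  obtain b \<gamma> where b: "0 < b" "eps q = EQ \<gamma> b"
    using eps_nonconst[OF q(1)] by metis
  interpret S: gen_valuation "\<lambda>f. scale_value b (\<nu> f)"
    by (rule gen_valuation_nu_scale) fact
  obtain k D where kD: "S.gauss \<gamma> (taylor q) k D" "0 < D" "scale_value b (\<nu> q) = Fin k"
    using gauss_attained[OF q(1) b(2,1)] by metis
  have below: "\<forall>r. r \<noteq> 0 \<and> degree r < degree q \<longrightarrow> (\<exists>m. S.gauss \<gamma> (taylor r) m 0)"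
    using q(2) gauss_below b unfolding eps_below_def by simp
  obtain i\<^sub>0 m where i0: "S.gauss \<gamma> (taylor h) m (i\<^sub>0 * D)" "i\<^sub>0 \<le> degree h"
      "scale_value b (\<nu> (qexp_coeff q h i\<^sub>0 * q ^ i\<^sub>0)) = Fin m"
    and le: "\<And>i. Fin m \<le> scale_value b (\<nu> (qexp_coeff q h i * q ^ i))"
    by (rule gauss_taylor_expansion[OF S.gen_valuation_axioms scale_nu_Pinf_iff q(1) kD below h]) blast
  have m: "scale_value b (\<nu> h) = Fin m"
  proof (rule antisym)
    have "eps_le (eps h) (EQ \<gamma> b)" using max[OF h] b by simp
    then show "scale_value b (\<nu> h) \<le> Fin m"
      using eps_le_iff[OF h] i0(1) unfolding S.gauss_def coeff_taylor by metis
    have "Fin m \<le> scale_value b (\<nu> (hasse_deriv 0 h)) + Fin (gmul 0 \<gamma>)"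
      using i0(1) unfolding S.gauss_def coeff_taylor by metis
    then show "Fin m \<le> scale_value b (\<nu> h)" using h by (simp add: nu_val)
  qed
  have ge: "\<nu> h \<le> \<nu> (qexp_coeff q h i * q ^ i)" for i
    using le[of i] m scale_value_le_iff[OF b(1)] by metis
  have "\<nu> (qexp_coeff q h i\<^sub>0 * q ^ i\<^sub>0) \<le> \<nu> h"
    using i0(3) m scale_value_le_iff[OF b(1)] by (metis order_refl)
  with ge have eq: "\<nu> (qexp_coeff q h i\<^sub>0 * q ^ i\<^sub>0) = \<nu> h" by (metis order_antisym)
  show ?thesis unfolding truncation_def
    by (rule Min_eqI[symmetric]) (use ge eq[symmetric] i0(2) in auto)
qed

text \<open>The coefficients come from a linear dependence of the \<open>n + 1\<close> remainders modulo \<open>q\<close>, where \<open>n = deg q\<close>.\<close>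
lemma homogeneous_relation:
  assumes q: "0 < degree q" "eps_below q"
    and fg: "f \<noteq> 0" "g \<noteq> 0" "\<not> eps_le (eps q) (eps (f * g))"
  obtains c :: "nat \<Rightarrow> 'a" and n where "\<exists>i\<le>n. c i \<noteq> 0"
    "\<forall>m. (\<forall>i\<le>n. Fin m \<le> \<nu> (smult (c i) (f ^ i * g ^ (n - i)))) \<longrightarrow>
       Fin m < \<nu> (\<Sum>i\<le>n. smult (c i) (f ^ i * g ^ (n - i)))"
proof -
  define n where "n = degree q"
  define t where "t i = f ^ i * g ^ (n - i)" for i
  obtain b \<gamma> where b: "0 < b" "eps q = EQ \<gamma> b"
    using eps_nonconst[OF q(1)] by metis
  interpret S: gen_valuation "\<lambda>f. scale_value b (\<nu> f)"
    by (rule gen_valuation_nu_scale) fact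
  obtain k D where kD: "S.gauss \<gamma> (taylor q) k D" "0 < D" "scale_value b (\<nu> q) = Fin k"
    using gauss_attained[OF q(1) b(2,1)] by metis
  have below: "\<forall>r. r \<noteq> 0 \<and> degree r < degree q \<longrightarrow> (\<exists>m. S.gauss \<gamma> (taylor r) m 0)"
    using q(2) gauss_below b unfolding eps_below_def by simp
  obtain m where "S.gauss \<gamma> (taylor (f * g)) m 0"
    using gauss_below[of "f * g" b \<gamma>] fg b by auto
  then obtain m1 m2 where m12: "S.gauss \<gamma> (taylor f) m1 0" "S.gauss \<gamma> (taylor g) m2 0"
    using gauss_taylor_mult_0[OF S.gen_valuation_axioms scale_nu_Pinf_iff _ fg(1,2)] by blast
  have t: "\<nu> (t i) < \<nu> (t i - t i mod q)" for i
  proof -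
    have "S.gauss \<gamma> (taylor (t i)) (gmul i m1 + gmul (n - i) m2) (i * 0 + (n - i) * 0)"
      unfolding t_def taylor_mult taylor_power by (intro S.gauss_mult S.gauss_power m12)
    then have *: "S.gauss \<gamma> (taylor (t i)) (gmul i m1 + gmul (n - i) m2) 0" by simp
    have "t i \<noteq> 0" using fg by (simp add: t_def)
    from mod_approximates[OF S.gen_valuation_axioms scale_nu_Pinf_iff q(1) kD below this *]
    show ?thesis using b(1) by (simp add: scale_value_less_iff)
  qed
  have "\<exists>c. (\<exists>i\<in>{..n}. c i \<noteq> 0) \<and> (\<Sum>i\<in>{..n}. smult (c i) (t i mod q)) = 0"
  proof (rule poly_family_dependent)
    show "n < card {..n}" by simp
    fix i k assume "n \<le> k"
    then have "degree (t i mod q) < k"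
      using degree_mod_less[of q "t i"] q(1) unfolding n_def by fastforce
    then show "coeff (t i mod q) k = 0" by (rule coeff_eq_0)
  qed simp
  then obtain c where c: "\<exists>i\<le>n. c i \<noteq> 0" "(\<Sum>i\<le>n. smult (c i) (t i mod q)) = 0" by auto
  have "Fin m < \<nu> (\<Sum>i\<le>n. smult (c i) (t i))"
    if m: "\<And>i. i \<le> n \<Longrightarrow> Fin m \<le> \<nu> (smult (c i) (t i))" for m
  proof -
    \<comment> \<open>The remainders cancel by the linear relation, so each term may be replaced by
      its error, which has a larger value.\<close>
    have "(\<Sum>i\<le>n. smult (c i) (t i)) = (\<Sum>i\<le>n. smult (c i) (t i - t i mod q))"
      using c(2) by (simp add: smult_diff_right sum_subtractf)
    also have "Fin m < \<nu> \<dots>"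
    proof (rule V_sum_gt)
      fix i assume "i \<in> {..n}"
      show "Fin m < \<nu> (smult (c i) (t i - t i mod q))"
      proof (cases "c i = 0")
        case False
        then have "\<nu> [:c i:] = Fin (val [:c i:])" by (simp add: nu_val)
        then have "\<nu> (smult (c i) (t i)) < \<nu> (smult (c i) (t i - t i mod q))"
          using t[of i] unfolding nu_smult by (simp add: add.commute[of "Fin _"])
        then show ?thesis using m[of i] \<open>i \<in> {..n}\<close> by (simp add: order.strict_trans1)
      qed simp
    qed
    finally show ?thesis .
  qed
  then show thesis using c(1) unfolding t_def by (intro that) auto
qed

section \<open>Consequences of the existence or absence of a maximal \<epsilon>\<close>

text \<open>Any f with \<epsilon>(f) at least the maximum attains it too, so minimality of the
  degree is exactly the key polynomial condition.\<close>

lemma key_polynomial_if_eps_max: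
  assumes h: "h \<noteq> 0" and max: "\<And>f. f \<noteq> 0 \<Longrightarrow> eps_le (eps f) (eps h)"
  shows "\<exists>Q. key_polynomial \<nu> Q \<and> 0 < degree Q \<and> (\<forall>f. \<nu> f = truncation \<nu> Q f)"
proof -
  let ?P = "\<lambda>q. q \<noteq> 0 \<and> eps_le (eps h) (eps q)"
  obtain q where q: "?P q" and min: "\<And>f. ?P f \<Longrightarrow> degree q \<le> degree f"
    using ex_has_least_nat[of ?P h degree] h eps_le_refl by blast
  define Q where "Q = smult (inverse (lead_coeff q)) q"
  have Q: "Q \<noteq> 0" "lead_coeff Q = 1" "eps Q = eps q" "degree Q = degree q"
    using q by (auto simp: Q_def eps_smult)
  have maxQ: "eps_le (eps f) (eps Q)" if "f \<noteq> 0" for f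
    using eps_trans[OF max[OF that]] q h Q(3) by simp
  have pos: "0 < degree Q"
  proof (rule ccontr)
    assume "\<not> 0 < degree Q"
    then have "eps Q = ENegInf" using eps_const Q by simp
    \<comment> \<open>The polynomial x has an \<epsilon> above that of constants, so no constant
      attains the maximum.\<close>
    moreover have "0 < degree [:0, 1 :: 'a:]" by simp
    from eps_nonconst[OF this] obtain b \<gamma> where "eps [:0, 1:] = EQ \<gamma> b" by metis
    ultimately show False using maxQ[of "[:0, 1:]"] by simp
  qed
  have minQ: "degree Q \<le> degree f" if "f \<noteq> 0" "eps_le (eps Q) (eps f)" for f
    using min[of f] that q Q eps_trans[of "eps h" q "eps f"] by simp
  have "eps_below Q" unfolding eps_below_def using minQ leD by blast
  moreover have "key_polynomial \<nu> Q"
    unfolding key_polynomial_def eps_defined_iff using Q minQ eps_ge_iff by auto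
  ultimately show ?thesis using pos nu_eq_truncation maxQ by blast
qed

text \<open>Some polynomial exceeds \<epsilon>(f g). One of least degree satisfies
  \<open>eps_below\<close>, since a polynomial of smaller degree with at least the same \<epsilon>
  would exceed \<epsilon>(f g) as well.\<close>

lemma homogeneous_relation_if_no_eps_max:
  assumes no_max: "\<And>h. h \<noteq> 0 \<Longrightarrow> \<exists>f. f \<noteq> 0 \<and> \<not> eps_le (eps f) (eps h)"
    and fg: "f \<noteq> 0" "g \<noteq> 0"
  obtains c :: "nat \<Rightarrow> 'a" and n where "\<exists>i\<le>n. c i \<noteq> 0"
    "\<forall>m. (\<forall>i\<le>n. Fin m \<le> \<nu> (smult (c i) (f ^ i * g ^ (n - i)))) \<longrightarrow>
       Fin m < \<nu> (\<Sum>i\<le>n. smult (c i) (f ^ i * g ^ (n - i)))"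
proof -
  let ?h = "f * g"
  have h: "?h \<noteq> 0" using fg by simp
  let ?P = "\<lambda>q. q \<noteq> 0 \<and> \<not> eps_le (eps q) (eps ?h)"
  obtain q' where "?P q'" using no_max[OF h] by blast
  then obtain q where q: "?P q" and min: "\<And>f. ?P f \<Longrightarrow> degree q \<le> degree f"
    using ex_has_least_nat[of ?P q' degree] by blast
  have below: "eps_below q" unfolding eps_below_def
  proof (intro allI impI notI)
    fix r assume r: "r \<noteq> 0 \<and> degree r < degree q" "eps_le (eps q) (eps r)"
    then have "\<not> ?P r" using min[of r] leD by blast
    then show False using r q eps_trans by blast
  qed
  have pos: "0 < degree q"
  proof (rule ccontr)
    assume "\<not> 0 < degree q"
    then have "eps q = ENegInf" using q by (simp add: eps_const)
    then show False using q by simp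
  qed
  have "\<not> eps_le (eps q) (eps ?h)" using q by blast
  then show thesis by (rule homogeneous_relation[OF pos below fg]) (erule (1) that)
qed

text \<open>If the nonzero terms of the relation had distinct values, the sum would have the least
  of them, against the relation. So two terms have equal value, and comparing them expresses a
  positive multiple of \<gamma> as the value of a quotient of coefficients.\<close>

lemma torsion_if_no_eps_max:
  assumes no_max: "\<And>h. h \<noteq> 0 \<Longrightarrow> \<exists>f. f \<noteq> 0 \<and> \<not> eps_le (eps f) (eps h)"
  shows "value_quotient_torsion \<nu>"
  unfolding value_quotient_torsion_def
proof
  fix \<gamma> assume "\<gamma> \<in> value_group_Kx \<nu>"
  then obtain f g where fg: "f \<noteq> 0" "g \<noteq> 0" and \<gamma>: "\<gamma> = val f - val g"
    unfolding value_group_Kx_def val_def by auto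
  obtain c :: "nat \<Rightarrow> 'a" and n where c: "\<exists>i\<le>n. c i \<noteq> 0"
    and rel: "\<forall>m. (\<forall>i\<le>n. Fin m \<le> \<nu> (smult (c i) (f ^ i * g ^ (n - i)))) \<longrightarrow>
       Fin m < \<nu> (\<Sum>i\<le>n. smult (c i) (f ^ i * g ^ (n - i)))"
    by (rule homogeneous_relation_if_no_eps_max[OF no_max fg])
  define t where "t i = smult (c i) (f ^ i * g ^ (n - i))" for i
  define I where "I = {i. i \<le> n \<and> c i \<noteq> 0}"
  have I: "finite I" "I \<noteq> {}" using c unfolding I_def by auto
  have t: "\<nu> (t i) = Fin (val [:c i:] + gmul i (val f) + gmul (n - i) (val g))" if "i \<in> I" for i
    using that fg unfolding t_def I_def
    by (simp add: nu_val val_smult val_mult val_power add.assoc)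
  define u where "u i = val [:c i:] + gmul i (val f) + gmul (n - i) (val g)" for i
  obtain i where i: "i \<in> I" "\<And>j. j \<in> I \<Longrightarrow> u i \<le> u j"
    using arg_min_if_finite[OF I, of u] by (metis linorder_not_less)
  have t_ge: "Fin (u i) \<le> \<nu> (t j)" if "j \<le> n" for j
    using t[of j] i(2)[of j] that unfolding I_def u_def by (cases "c j = 0") (auto simp: t_def)
  have "Fin (u i) < \<nu> (sum t {..n})" using rel[rule_format, of "u i"] t_ge unfolding t_def by simp
  moreover have "\<nu> (sum t {..n}) = Fin (u i)"
    if "\<And>j. j \<in> I \<Longrightarrow> j \<noteq> i \<Longrightarrow> u i \<noteq> u j"
  proof (rule V_sum_eq)
    show "i \<in> {..n}" using i unfolding I_def by simp
    show "\<nu> (t i) = Fin (u i)" using t[OF i(1)] unfolding u_def .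
    fix j assume j: "j \<in> {..n}" "j \<noteq> i"
    show "Fin (u i) < \<nu> (t j)"
    proof (cases "c j = 0")
      case False
      then have "j \<in> I" using j unfolding I_def by simp
      then have "\<nu> (t j) = Fin (u j)" "u i \<le> u j" "u i \<noteq> u j" using t i(2) that j unfolding u_def by auto
      then show ?thesis by simp
    qed (simp add: t_def)
  qed simp
  ultimately obtain j where j: "j \<in> I" "j \<noteq> i" "u i = u j" by fastforce
  have torsion: "\<exists>n>0. gmul n \<gamma> \<in> value_group_K \<nu>"
    if "i \<in> I" "j \<in> I" "i < j" "u i = u j" for i j
  proof -
    obtain d where d: "j = i + d" "0 < d" using \<open>i < j\<close> by (metis less_imp_add_positive)
    have ni: "n - i = d + (n - j)" using d that(2) unfolding I_def by simp
    have "gmul d \<gamma> = val [:c i:] - val [:c j:]"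
      using that(4) unfolding u_def \<gamma> ni d(1) gmul_add gmul_diff by (simp add: algebra_simps)
    moreover have nz: "c i \<noteq> 0" "c j \<noteq> 0" using that unfolding I_def by auto
    moreover have "val [:c i:] = val [:c i / c j:] + val [:c j:]"
      using val_mult[of "[:c i / c j:]" "[:c j:]"] nz by simp
    ultimately have "gmul d \<gamma> = val [:c i / c j:]" by simp
    then show ?thesis using d(2) nz unfolding value_group_K_def val_def
      by (intro exI[of _ d]) (auto intro!: exI[of _ "c i / c j"])
  qed
  show "\<exists>n>0. gmul n \<gamma> \<in> value_group_K \<nu>"
    using torsion[of i j] torsion[of j i] i(1) j by (metis linorder_neqE_nat)
qed

lemma residue_algebraic_if_no_eps_max:
  assumes no_max: "\<And>h. h \<noteq> 0 \<Longrightarrow> \<exists>f. f \<noteq> 0 \<and> \<not> eps_le (eps f) (eps h)"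
    and g: "g \<noteq> 0" and le: "\<nu> g \<le> \<nu> f"
  shows "residue_algebraic \<nu> f g"
proof (cases "\<nu> g < \<nu> f")
  case True
  \<comment> \<open>Here the residue of \<open>f/g\<close> is 0, a root of the polynomial T.\<close>
  define c :: "nat \<Rightarrow> 'a" where "c i = (if i = 1 then 1 else 0)" for i
  have "(\<Sum>i\<le>1. smult (c i) (f ^ i * g ^ (1 - i))) = f"
    by (simp add: c_def)
  moreover have "Fin 0 \<le> \<nu> [:c i:]" for i
    by (simp add: c_def flip: one_pCons)
  moreover have "\<nu> [:c 1:] = Fin 0" by (simp add: c_def flip: one_pCons)
  ultimately show ?thesis unfolding residue_algebraic_def using True
    by (intro exI[of _ 1] exI[of _ c]) (auto simp del: One_nat_def)
next
  case False
  with le have eq: "\<nu> f = \<nu> g" by simp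
  then have f: "f \<noteq> 0" using g nu_Pinf_iff by metis
  have veq: "val f = val g" using eq by (simp add: val_def)
  obtain c :: "nat \<Rightarrow> 'a" and n where c: "\<exists>i\<le>n. c i \<noteq> 0"
    and rel: "\<forall>m. (\<forall>i\<le>n. Fin m \<le> \<nu> (smult (c i) (f ^ i * g ^ (n - i)))) \<longrightarrow>
       Fin m < \<nu> (\<Sum>i\<le>n. smult (c i) (f ^ i * g ^ (n - i)))"
    by (rule homogeneous_relation_if_no_eps_max[OF no_max f g])
  define I where "I = {i. i \<le> n \<and> c i \<noteq> 0}"
  have I: "finite I" "I \<noteq> {}" using c unfolding I_def by auto
  obtain k where k: "k \<in> I" "\<And>j. j \<in> I \<Longrightarrow> val [:c k:] \<le> val [:c j:]"
    using arg_min_if_finite[OF I, of "\<lambda>i. val [:c i:]"] by (metis linorder_not_less)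
  have ck: "c k \<noteq> 0" "k \<le> n" using k(1) unfolding I_def by auto
  define t where "t i = f ^ i * g ^ (n - i)" for i
  have t: "\<nu> (t i) = \<nu> (g ^ n)" if "i \<le> n" for i
  proof -
    have "gmul n (val g) = gmul i (val g) + gmul (n - i) (val g)"
      using that by (simp flip: gmul_add)
    then show ?thesis using f g veq by (simp add: t_def nu_val val_mult val_power)
  qed
  \<comment> \<open>Division by a coefficient of least value makes all coefficients integral and the
    one at \<open>k\<close> a unit, so the reduced polynomial is nonzero.\<close>
  define d where "d i = c i / c k" for i
  have val_c: "val [:c i:] = val [:c k:] + val [:d i:]" if "c i \<noteq> 0" for i
    using val_mult[of "[:c k:]" "[:d i:]"] ck that by (simp add: d_def)
  have d_ge: "Fin 0 \<le> \<nu> [:d i:]" if "i \<le> n" for i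
  proof (cases "c i = 0")
    case False
    then have "val [:c k:] \<le> val [:c k:] + val [:d i:]"
      using k(2)[of i] val_c[of i] that unfolding I_def by simp
    then show ?thesis using False ck by (simp add: nu_val d_def)
  qed (simp add: d_def)
  have dk: "\<nu> [:d k:] = Fin 0" using ck by (simp add: d_def flip: one_pCons)
  \<comment> \<open>All products \<open>t i\<close> have the value of \<open>g ^ n\<close>, so the
    least coefficient value determines this common lower bound.\<close>
  define m where "m = val [:c k:] + val (g ^ n)"
  have "Fin m < \<nu> (\<Sum>i\<le>n. smult (c i) (t i))"
    unfolding t_def
  proof (rule rel[rule_format], fold t_def)
    fix i assume i: "i \<le> n"
    show "Fin m \<le> \<nu> (smult (c i) (t i))"
    proof (cases "c i = 0")
      case False
      then show ?thesis using t[OF i] k(2)[of i] i g unfolding nu_smult I_def m_def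
        by (simp add: nu_val)
    qed simp
  qed
  also have "(\<Sum>i\<le>n. smult (c i) (t i)) = smult (c k) (\<Sum>i\<le>n. smult (d i) (t i))"
    using ck sum_distrib_left[of "[:c k:]" "\<lambda>i. smult (d i) (t i)" "{..n}"] by (simp add: d_def)
  finally have "\<nu> (g ^ n) < \<nu> (\<Sum>i\<le>n. smult (d i) (t i))"
    using ck g unfolding nu_smult m_def
    by (cases "\<nu> (\<Sum>i\<le>n. smult (d i) (t i))") (simp_all add: nu_val)
  then show ?thesis unfolding residue_algebraic_def t_def using d_ge dk ck(2) by blast
qed

section \<open>The converse and the equivalence for Krull valuations\<close>

text \<open>In the torsion case, an algebraic relation for the residue of Q^n/a would, after
  clearing denominators, be a polynomial in Q over K. Its value under the truncation is at most that
  of each term, so the required cancellation is impossible.\<close>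

lemma valuation_transcendental_if_truncation:
  assumes Q: "0 < degree Q" and trunc: "\<And>f. \<nu> f = truncation \<nu> Q f"
  shows "valuation_transcendental \<nu>"
proof (cases "value_quotient_torsion \<nu>")
  case False
  then show ?thesis unfolding valuation_transcendental_def value_transcendental_def by blast
next
  case True
  have Q0: "Q \<noteq> 0" using Q by auto
  have "val Q \<in> value_group_Kx \<nu>"
    unfolding value_group_Kx_def val_def using Q0
    by (intro CollectI exI[of _ Q] exI[of _ 1]) simp
  then obtain n a where n: "0 < n" "a \<noteq> 0" "gmul n (val Q) = val [:a:]"
    using True unfolding value_quotient_torsion_def value_group_K_def val_def by auto
  have "\<not> residue_algebraic \<nu> (Q ^ n) [:a:]"
  proof
    assume "residue_algebraic \<nu> (Q ^ n) [:a:]"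
    then obtain N c k where c: "k \<le> N" "\<nu> [:c k:] = Fin 0"
      and gt: "\<nu> ([:a:] ^ N) < \<nu> (\<Sum>i\<le>N. smult (c i) ((Q ^ n) ^ i * [:a:] ^ (N - i)))"
      unfolding residue_algebraic_def by blast
    define P where "P = (\<Sum>i\<le>N. monom (c i * a ^ (N - i)) (n * i))"
    have mono: "pcompose (monom x i) Q = smult x (Q ^ i)" for x i
      by (induction i) (simp_all add: monom_0 monom_Suc pcompose_pCons)
    have const: "[:a:] ^ i = [:a ^ i:]" for i by (induction i) (simp_all add: one_pCons)
    have h: "(\<Sum>i\<le>N. smult (c i) ((Q ^ n) ^ i * [:a:] ^ (N - i))) = pcompose P Q"
      unfolding P_def pcompose_sum mono const by (simp add: power_mult)
    \<comment> \<open>The exponents \<open>n * i\<close> are distinct because \<open>n\<close> is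
      positive, so only \<open>i = k\<close> contributes.\<close>
    have "coeff P (n * k) = (\<Sum>i\<le>N. if i = k then c i * a ^ (N - i) else 0)"
      unfolding P_def coeff_sum using n(1) by (intro sum.cong) auto
    also have "\<dots> = c k * a ^ (N - k)" using c(1) by simp
    finally have coeff: "coeff P (n * k) = c k * a ^ (N - k)" .
    have ck: "c k \<noteq> 0" using c(2) by auto
    then have "n * k \<le> degree P" using coeff n(2) by (intro le_degree) simp
    \<comment> \<open>This places the index \<open>n * k\<close> in the range over which
      \<open>truncation\<close> takes its minimum.\<close>
    also have "\<dots> \<le> degree (pcompose P Q)" using Q by (simp add: degree_pcompose)
    finally have "n * k \<le> degree (pcompose P Q)" .
    then have "\<nu> (pcompose P Q) \<le> \<nu> (qexp_coeff Q (pcompose P Q) (n * k) * Q ^ (n * k))"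
      unfolding trunc[of "pcompose P Q"] truncation_def by (intro Min_le) auto
    also have "qexp_coeff Q (pcompose P Q) (n * k) * Q ^ (n * k) =
               smult (c k) ([:a:] ^ (N - k) * Q ^ (n * k))"
      unfolding qexp_coeff_pcompose[OF Q] coeff const by simp
    also have "\<nu> \<dots> = Fin (gmul (N - k) (val [:a:]) + gmul (n * k) (val Q))"
      using c(2) n(2) Q0 unfolding nu_smult by (simp add: nu_val val_mult val_power)
    also have "gmul (n * k) (val Q) = gmul k (val [:a:])"
      unfolding n(3)[symmetric] gmul_gmul by (simp add: mult.commute)
    also have "gmul (N - k) (val [:a:]) + gmul k (val [:a:]) = gmul N (val [:a:])"
      using c(1) by (simp flip: gmul_add)
    also have "Fin \<dots> = \<nu> ([:a:] ^ N)" using n(2) by (simp add: nu_val val_power)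
    finally show False using gt unfolding h by simp
  qed
  moreover have "\<nu> [:a:] \<le> \<nu> (Q ^ n)" using n Q0 by (simp add: nu_val val_power)
  moreover have "[:a:] \<noteq> 0" using n by simp
  ultimately show ?thesis
    using krull unfolding valuation_transcendental_def residue_transcendental_def by blast
qed

text \<open>Without a maximal \<epsilon> the value quotient is torsion and all residues are
  algebraic, so a valuation-transcendental \<nu> has a maximal one.\<close>

lemma valuation_transcendental_iff:
  "valuation_transcendental \<nu> \<longleftrightarrow>
     (\<exists>Q. key_polynomial \<nu> Q \<and> 0 < degree Q \<and> (\<forall>f. \<nu> f = truncation \<nu> Q f))"
proof
  assume trans: "valuation_transcendental \<nu>"
  have "\<exists>h. h \<noteq> 0 \<and> (\<forall>f. f \<noteq> 0 \<longrightarrow> eps_le (eps f) (eps h))"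
  proof (rule ccontr)
    assume "\<not> ?thesis"
    then have no_max: "\<exists>f. f \<noteq> 0 \<and> \<not> eps_le (eps f) (eps h)" if "h \<noteq> 0" for h
      using that by blast
    from torsion_if_no_eps_max[OF no_max] residue_algebraic_if_no_eps_max[OF no_max] trans krull
    show False
      unfolding valuation_transcendental_def value_transcendental_def residue_transcendental_def
      by blast
  qed
  then show "\<exists>Q. key_polynomial \<nu> Q \<and> 0 < degree Q \<and> (\<forall>f. \<nu> f = truncation \<nu> Q f)"
    using key_polynomial_if_eps_max by blast
qed (use valuation_transcendental_if_truncation in blast)

end

section \<open>Valuations with nonzero support\<close>

text \<open>The support is generated by a monic \<open>Q\<close>, and multiples of \<open>Q\<close>
  have value \<open>Pinf\<close>; hence both \<nu>(f) and its truncation equal the value of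
  \<open>f mod Q\<close>.\<close>

lemma truncation_if_not_krull:
  assumes "valuation \<nu>" "\<not> krull \<nu>"
  shows "\<exists>Q. key_polynomial \<nu> Q \<and> 0 < degree Q \<and> (\<forall>f. \<nu> f = truncation \<nu> Q f)"
proof -
  interpret gen_valuation \<nu> by (rule gen_valuation_if_valuation) fact
  have ideal: "f * h \<in> supp \<nu>" if "f \<in> supp \<nu>" for f h
    using that V_mult[of f h] V_not_Minf[of h] unfolding supp_def by (cases "\<nu> h") auto
  let ?P = "\<lambda>q. q \<in> supp \<nu> - {0}"
  have "0 \<in> supp \<nu>" by (simp add: supp_def)
  then obtain h where h: "?P h" using assms(2) unfolding krull_def by blast
  obtain q where q: "?P q" and min: "\<And>f. ?P f \<Longrightarrow> degree q \<le> degree f"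
    using ex_has_least_nat[of ?P h degree] h by blast
  define Q where "Q = q * [:inverse (lead_coeff q):]"
  have Q: "Q \<noteq> 0" "lead_coeff Q = 1" "degree Q = degree q" using q by (auto simp: Q_def)
  have Qs: "Q \<in> supp \<nu>" unfolding Q_def using ideal q by blast
  have pos: "0 < degree Q"
  proof (rule ccontr)
    assume "\<not> 0 < degree Q"
    then have "Q = 1" using Q(2) by (auto simp: one_pCons elim: degree_eq_zeroE)
    then show False using Qs by (simp add: supp_def)
  qed
  have sub: "f - g \<in> supp \<nu>" if "f \<in> supp \<nu>" "g \<in> supp \<nu>" for f g
    using that V_add[of f "- g"] unfolding supp_def by simp
  have dvd: "f \<in> supp \<nu> \<longleftrightarrow> Q dvd f" for f
  proof
    assume "Q dvd f" then show "f \<in> supp \<nu>" using ideal[OF Qs] by (auto elim: dvdE)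
  next
    assume f: "f \<in> supp \<nu>"
    have "f mod Q = f - Q * (f div Q)" by (simp add: minus_mult_div_eq_mod)
    then have m: "f mod Q \<in> supp \<nu>" using sub[OF f ideal[OF Qs]] by simp
    show "Q dvd f"
    proof (rule ccontr)
      assume "\<not> Q dvd f"
      then have "f mod Q \<noteq> 0" by (simp add: dvd_eq_mod_eq_0)
      then have "degree q \<le> degree (f mod Q)" "degree (f mod Q) < degree Q"
        using min m degree_mod_less[OF Q(1), of f] by auto
      then show False using Q(3) by simp
    qed
  qed
  have gen: "generates_supp \<nu> Q" unfolding generates_supp_def using Q(1) dvd by (auto simp: dvd_def)
  have cands: "eps_cands \<nu> Q = {EPosInf}" using pos gen by (simp add: eps_cands_def)
  \<comment> \<open>Only \<open>EPosInf\<close> lies above \<open>EPosInf\<close>, so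
    \<open>f\<close> must itself generate the support.\<close>
  have "degree Q \<le> degree f" if ge: "eps_ge \<nu> f Q" for f
  proof -
    obtain e where e: "e \<in> eps_cands \<nu> f" "eps_le EPosInf e" using ge cands unfolding eps_ge_def by auto
    then have "e = EPosInf" by (cases e) auto
    then have "generates_supp \<nu> f" using e(1) unfolding eps_cands_def by (auto split: if_splits)
    then have "f \<noteq> 0" "f * 1 \<in> supp \<nu>" unfolding generates_supp_def by blast+
    then show ?thesis using dvd[of f] dvd_imp_degree_le by auto
  qed
  then have key: "key_polynomial \<nu> Q" unfolding key_polynomial_def eps_defined_def using Q cands by simp
  have "\<nu> f = truncation \<nu> Q f" for f
  proof -
    have Suc: "\<nu> (qexp_coeff Q f i * Q ^ i) = Pinf" if "0 < i" for i
      using dvd[of "qexp_coeff Q f i * Q ^ i"] that unfolding supp_def by (simp add: dvd_power)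
    have "\<nu> (Q * (f div Q)) = Pinf" using ideal[OF Qs] unfolding supp_def by simp
    moreover have "f = f mod Q + Q * (f div Q)" by simp
    \<comment> \<open>If \<open>f mod Q\<close> has finite value it dominates the sum; otherwise
      both summands, and hence \<open>f\<close>, have value \<open>Pinf\<close>.\<close>
    ultimately have eq: "\<nu> f = \<nu> (qexp_coeff Q f 0 * Q ^ 0)"
      using V_add_eq[of "f mod Q" "Q * (f div Q)"] V_add[of "f mod Q" "Q * (f div Q)"]
      by (cases "\<nu> (f mod Q)") (auto simp: qexp_coeff_def)
    show ?thesis unfolding truncation_def
    proof (rule Min_eqI[symmetric])
      show "\<nu> f \<in> (\<lambda>i. \<nu> (qexp_coeff Q f i * Q ^ i)) ` {..degree f}" using eq by blast
      fix y assume "y \<in> (\<lambda>i. \<nu> (qexp_coeff Q f i * Q ^ i)) ` {..degree f}"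
      then obtain i where "y = \<nu> (qexp_coeff Q f i * Q ^ i)" by blast
      then show "\<nu> f \<le> y" using Suc[of i] eq by (cases "i = 0") auto
    qed simp
  qed
  then show ?thesis using key pos by blast
qed

text \<open>The conjunct \<open>0 < degree Q\<close> reflects that truncations are taken at
  nonconstant polynomials. A non-Krull \<nu> is value-transcendental by definition, so there only
  the existence of \<open>Q\<close> has to be shown.\<close>

theorem theorem1p1:
  fixes \<nu> :: "'a::field poly \<Rightarrow> 'g::linordered_ab_group_add extended"
  assumes "valuation \<nu>"
  shows "valuation_transcendental \<nu> \<longleftrightarrow>
         (\<exists>Q. key_polynomial \<nu> Q \<and> 0 < degree Q \<and> (\<forall>f. \<nu> f = truncation \<nu> Q f))"
proof (cases "krull \<nu>")
  case True
  with assms interpret krull_valuation \<nu> by unfold_locales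
  show ?thesis by (rule valuation_transcendental_iff)
next
  case False
  then show ?thesis using truncation_if_not_krull[OF assms]
    unfolding valuation_transcendental_def value_transcendental_def by blast
qed

end
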